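(* Let $V$ be a finite set, $\mathbf k$ a field, $U_v$ a finite-dimensional $\mathbf k$-vector space for each $v\in V$, and $U=\bigoplus_{v\in V}U_v$. Let $W\subseteq U$ be a subspace and $\varphi=\nu^*_W$ its submodular function. Let $\mathcal J$ be a sequence of subsets $J_1,\dots,J_d$ of $V$ such that $\varphi+\xi_{\mathcal J}\ge0$. For each $i=1,\dots,d$ and $v\in J_i$, let $H_{i,v}\subseteq U_v$ be a subspace of codimension at most $1$. Assume that for each collection $\mathscr S$ of subsets $S_i\subseteq J_i$ for $i=1,\dots,d$ verifying the inequality $$\varphi+\sum_{i=1}^d\sum_{v\in S_i}\xi_v\ge0,$$ the space $$W(\mathscr S)=W\cap\bigcap_{i=1}^d\bigcap_{v\in S_i}\theta_v^{-1}(H_{i,v})$$ has submodular function $\mathrm{UpMin}\bigl(\varphi+\sum_{i=1}^d\sum_{v\in S_i}\xi_v\bigr)$. Then $\bigoplus_{v\in J_i}H_{i,v}$ is a proper subspace of $U_{J_i}$ for each $i=1,\dots,d$. Moreover, letting $\mathscr H$ be a collection of general hyperplanes $H_i\subset U_{J_i}$ containing $\bigoplus_{v\in J_i}H_{i,v}$ for $i=1,\dots,d$, the space $$W(\mathscr H)=W\cap\bigcap_{i=1}^d\theta_{J_i}^{-1}(H_i)$$ has submodular function $\mathrm{UpMin}(\varphi+\xi_{\mathcal J})$.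
   Context: For $I\subseteq V$, $U_I=\bigoplus_{v\in I}U_v$ and $\theta_I\colon U\to U_I$ is the natural projection, $\theta_v=\theta_{\{v\}}$. The submodular function of a subspace $W\subseteq U$ is $\nu^*_W\colon2^V\to\mathbb Z$, $\nu^*_W(I)=\dim_{\mathbf k}\theta_I(W)$. For $J\subseteq V$, $\xi_J\colon2^V\to\mathbb Z$ is $\xi_J(I)=-1$ if $I\supseteq J$ and $0$ otherwise; $\xi_v=\xi_{\{v\}}$; $\xi_{\mathcal J}=\sum_{i=1}^d\xi_{J_i}$. For $\varphi\colon2^V\to\mathbb R$, $\varphi\ge0$ means that all values are nonnegative, and $\mathrm{UpMin}(\varphi)(I)=\min_{K\supseteq I}\varphi(K)$. "General hyperplanes" means that the tuple $(H_1,\dots,H_d)$ lies in a suitable nonempty Zariski-open subset of the product over $i$ of the projective spaces parametrizing hyperplanes of $U_{J_i}$ that contain $\bigoplus_{v\in J_i}H_{i,v}$. *)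

theory Defs
  imports
    Complex_Main
    "HOL-Library.Function_Algebras"
    "HOL-Library.Poly_Mapping"
begin

section \<open>Direct sums and projections\<close>

text \<open>
  The spaces \<open>U v\<close> are subspaces of one ambient vector space \<open>'u\<close> of arbitrary dimension, with
  scalar multiplication \<open>scale\<close>. This loses nothing: any family of vector spaces embeds in its
  direct sum, and no relation between the \<open>U v\<close> inside \<open>'u\<close> is assumed.
  Their external direct sum over \<open>I\<close> consists of the functions \<open>'v \<Rightarrow> 'u\<close> with values
  in \<open>U v\<close> for \<open>v \<in> I\<close> that vanish outside \<open>I\<close>. The index sets are finite throughout.
\<close>

definition pscale :: "('k \<Rightarrow> 'u \<Rightarrow> 'u) \<Rightarrow> 'k \<Rightarrow> ('v \<Rightarrow> 'u) \<Rightarrow> ('v \<Rightarrow> 'u)" where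
  "pscale scale c x = (\<lambda>v. scale c (x v))"

lemma vector_space_pscale:
  assumes "vector_space scale"
  shows "vector_space (pscale scale)"
proof -
  interpret vector_space scale by fact
  show ?thesis
    by unfold_locales
      (auto simp: pscale_def fun_eq_iff scale_right_distrib scale_left_distrib)
qed

definition direct_sum :: "'v set \<Rightarrow> ('v \<Rightarrow> 'u set) \<Rightarrow> ('v \<Rightarrow> 'u::zero) set" where
  "direct_sum I A = {x. (\<forall>v\<in>I. x v \<in> A v) \<and> (\<forall>v. v \<notin> I \<longrightarrow> x v = 0)}"

definition proj :: "'v set \<Rightarrow> ('v \<Rightarrow> 'u) \<Rightarrow> ('v \<Rightarrow> 'u::zero)" where
  "proj I x = (\<lambda>v. if v \<in> I then x v else 0)"

definition finite_dim :: "('k::field \<Rightarrow> 'u \<Rightarrow> 'u::ab_group_add) \<Rightarrow> 'u set \<Rightarrow> bool" where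
  "finite_dim scale X \<longleftrightarrow> (\<exists>B. finite B \<and> X \<subseteq> module.span scale B)"


section \<open>Submodular functions\<close>

text \<open>Functions on the power set of \<open>V\<close> are functions \<open>'v set \<Rightarrow> _\<close> whose values matter only on
  subsets of \<open>V\<close>.\<close>

definition submod_fun ::
    "('k::field \<Rightarrow> 'u \<Rightarrow> 'u::ab_group_add) \<Rightarrow> ('v \<Rightarrow> 'u) set \<Rightarrow> 'v set \<Rightarrow> int" where
  "submod_fun scale W I = int (vector_space.dim (pscale scale) (proj I ` W))"

definition has_submod_fun ::
    "('k::field \<Rightarrow> 'u \<Rightarrow> 'u::ab_group_add) \<Rightarrow> 'v set \<Rightarrow> ('v \<Rightarrow> 'u) set \<Rightarrow> ('v set \<Rightarrow> int) \<Rightarrow> bool" where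
  "has_submod_fun scale V W \<phi> \<longleftrightarrow> (\<forall>I\<subseteq>V. submod_fun scale W I = \<phi> I)"

definition xi :: "'v set \<Rightarrow> 'v set \<Rightarrow> int" where
  "xi J I = (if J \<subseteq> I then -1 else 0)"

definition nonneg_on :: "'v set \<Rightarrow> ('v set \<Rightarrow> int) \<Rightarrow> bool" where
  "nonneg_on V \<phi> \<longleftrightarrow> (\<forall>I\<subseteq>V. 0 \<le> \<phi> I)"

definition UpMin :: "'v set \<Rightarrow> ('v set \<Rightarrow> int) \<Rightarrow> 'v set \<Rightarrow> int" where
  "UpMin V \<phi> I = Min (\<phi> ` {K. I \<subseteq> K \<and> K \<subseteq> V})"


section \<open>General hyperplanes\<close>

definition hyperplane ::
    "('k::field \<Rightarrow> 'w \<Rightarrow> 'w::ab_group_add) \<Rightarrow> 'w set \<Rightarrow> 'w set \<Rightarrow> bool" where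
  "hyperplane s X H \<longleftrightarrow> module.subspace s H \<and> H \<subseteq> X \<and>
     vector_space.dim s X = vector_space.dim s H + 1"

text \<open>
  Hyperplanes of \<open>X\<close> containing \<open>N\<close> are the points of the projective space of nonzero linear forms
  on \<open>X/N\<close> up to scalars. If the elements of \<open>E\<close> give a basis of \<open>X/N\<close>, homogeneous
  coordinates of the hyperplane \<open>ker \<ell>\<close> are the scalars \<open>\<ell> e\<close> for \<open>e \<in> E\<close>. A change of \<open>E\<close> is
  an invertible linear change of these coordinates.
\<close>

definition quotient_basis ::
    "('k::field \<Rightarrow> 'w \<Rightarrow> 'w::ab_group_add) \<Rightarrow> 'w set \<Rightarrow> 'w set \<Rightarrow> 'w set \<Rightarrow> bool" where
  "quotient_basis s X N E \<longleftrightarrow> finite E \<and> E \<subseteq> X \<and> \<not> module.dependent s E \<and>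
     module.span s E \<inter> N = {0} \<and> module.span s (E \<union> N) = X"

text \<open>Multivariate polynomials with variables in \<open>'x\<close> and coefficients in \<open>'k\<close> are elements
  of \<open>('x \<Rightarrow>\<^sub>0 nat) \<Rightarrow>\<^sub>0 'k\<close>. The variable for the coordinate \<open>e \<in> E i\<close> of the \<open>i\<close>-th factor
  is \<open>(i, e)\<close>.\<close>

definition poly_eval :: "(('x \<Rightarrow>\<^sub>0 nat) \<Rightarrow>\<^sub>0 'k::comm_semiring_1) \<Rightarrow> ('x \<Rightarrow> 'k) \<Rightarrow> 'k" where
  "poly_eval f c = (\<Sum>m\<in>Poly_Mapping.keys f. Poly_Mapping.lookup f m *
     (\<Prod>x\<in>Poly_Mapping.keys m. c x ^ Poly_Mapping.lookup m x))"

definition multihomogeneous ::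
    "'i set \<Rightarrow> ('i \<Rightarrow> 'w set) \<Rightarrow> (('i \<times> 'w \<Rightarrow>\<^sub>0 nat) \<Rightarrow>\<^sub>0 'k::zero) \<Rightarrow> bool" where
  "multihomogeneous A E f \<longleftrightarrow> (\<exists>deg. \<forall>m\<in>Poly_Mapping.keys f.
     Poly_Mapping.keys m \<subseteq> Sigma A E \<and>
     (\<forall>i\<in>A. (\<Sum>e\<in>E i. Poly_Mapping.lookup m (i, e)) = deg i))"

text \<open>
  A Zariski-open subset of the product over \<open>i \<in> A\<close> of these projective spaces is given by a set \<open>F\<close>
  of multihomogeneous polynomials, as the locus where some member of \<open>F\<close> does not vanish.
  The product is an integral scheme, so the open subset is nonempty iff some member of \<open>F\<close> is
  nonzero as a polynomial. Over a finite field this is not the same as having a rational point.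
\<close>

definition zariski_open_points ::
    "('k::field \<Rightarrow> 'w \<Rightarrow> 'w::ab_group_add) \<Rightarrow> 'i set \<Rightarrow> ('i \<Rightarrow> 'w set) \<Rightarrow> ('i \<Rightarrow> 'w set) \<Rightarrow>
     ('i \<Rightarrow> 'w set) \<Rightarrow> (('i \<times> 'w \<Rightarrow>\<^sub>0 nat) \<Rightarrow>\<^sub>0 'k) set \<Rightarrow> ('i \<Rightarrow> 'w set) set" where
  "zariski_open_points s A X N E F =
     {H. (\<forall>i\<in>A. hyperplane s (X i) (H i) \<and> N i \<subseteq> H i) \<and>
         (\<exists>l. (\<forall>i\<in>A. Vector_Spaces.linear s (*) (l i) \<and> H i = {x\<in>X i. l i x = 0}) \<and>
              (\<exists>f\<in>F. poly_eval f (\<lambda>(i, e). l i e) \<noteq> 0))}"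

definition for_general_hyperplanes ::
    "('k::field \<Rightarrow> 'w \<Rightarrow> 'w::ab_group_add) \<Rightarrow> 'i set \<Rightarrow> ('i \<Rightarrow> 'w set) \<Rightarrow> ('i \<Rightarrow> 'w set) \<Rightarrow>
     (('i \<Rightarrow> 'w set) \<Rightarrow> bool) \<Rightarrow> bool" where
  "for_general_hyperplanes s A X N P \<longleftrightarrow>
     (\<exists>E F. (\<forall>i\<in>A. quotient_basis s (X i) (N i) (E i)) \<and>
            (\<forall>f\<in>F. multihomogeneous A E f) \<and> (\<exists>f\<in>F. f \<noteq> 0) \<and>
            (\<forall>H\<in>zariski_open_points s A X N E F. P H))"

end

theory Submission
  imports Defs "Jordan_Normal_Form.Determinant"
begin

text \<open>
  Let \<open>K\<^sub>I\<close> be the kernel of \<open>\<theta>\<^sub>I\<close> on \<open>W\<close>, and write \<open>H\<^sub>i\<close> as the kernel of a form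
  \<open>L\<^sub>i = \<Sum> c\<^sub>i\<^sub>v a\<^sub>i\<^sub>v\<close>, where \<open>a\<^sub>i\<^sub>v\<close> is a fixed form on \<open>U\<^sub>v\<close> with
  kernel \<open>H\<^sub>i\<^sub>v\<close> (the zero form if \<open>H\<^sub>i\<^sub>v = U\<^sub>v\<close>). By rank-nullity the claim reduces to the inequality \<open>rank (L | K\<^sub>I) \<ge> m\<^sub>I\<close> for all \<open>I\<close>, where
  \<open>m\<^sub>I = min {\<phi>(K) - \<phi>(I) + #{i. \<not> J\<^sub>i \<subseteq> K} | K \<supseteq> I}\<close>, as \<open>m\<^sub>\<emptyset> = d\<close>; the opposite inequality
  holds for every choice of coefficients.
  The rank condition is the nonvanishing of one of the minors of \<open>L | K\<^sub>I\<close>, so it suffices to reach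
  rank \<open>m\<^sub>I\<close> at one point for each \<open>I\<close> separately and to multiply the minors.
  Rado's theorem for the polymatroid contracted by \<open>I\<close> yields indices \<open>T\<close> with \<open>|T| = m\<^sub>I\<close> and
  elements \<open>v\<^sub>i \<in> J\<^sub>i\<close> for \<open>i \<in> T\<close> that are independent over \<open>I\<close>. The hypothesis for \<open>S\<^sub>i = {v\<^sub>i}\<close> then says
  that the forms \<open>a\<^sub>i\<^sub>v\<close> with \<open>v = v\<^sub>i\<close> are linearly independent on \<open>K\<^sub>I\<close>. So the coefficients
  \<open>c\<^sub>i\<^sub>v = 1\<close> for \<open>v = v\<^sub>i\<close>, and \<open>0\<close> otherwise, do it.
\<close>

section \<open>Finite-dimensional subspaces and common kernels\<close>

context vector_space
begin

text \<open>\<open>dim\<close> is the cardinality of a basis, hence 0 on a space without a finite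
  basis, and the ambient space may have any dimension. Finiteness is therefore carried along as
  \<open>finite_dim\<close> of the larger set.\<close>

lemma dim_mono_finite_dim:
  assumes "X \<subseteq> Y" and "finite_dim scale Y"
  shows "dim X \<le> dim Y"
proof -
  from assms(2) obtain B where B: "finite B" "Y \<subseteq> span B" by (auto simp: finite_dim_def)
  obtain C where C: "C \<subseteq> Y" "independent C" "Y \<subseteq> span C" "card C = dim Y" by (rule basis_exists)
  have "finite C" using independent_span_bound[OF B(1) C(2)] B C by auto
  then show ?thesis using dim_le_card[of X C] C assms by auto
qed

lemma finite_dim_subset: "X \<subseteq> Y \<Longrightarrow> finite_dim scale Y \<Longrightarrow> finite_dim scale X"
  by (auto simp: finite_dim_def)

lemma finite_dim_independent_finite:
  assumes "finite_dim scale X" "B \<subseteq> X" "independent B"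
  shows "finite B"
  using assms independent_span_bound[of _ B] by (auto simp: finite_dim_def)

lemma subspace_dim_eq_finite_dim:
  assumes "X \<subseteq> Y" "finite_dim scale Y" "subspace X" "dim Y \<le> dim X"
  shows "X = Y"
proof -
  obtain B where B: "B \<subseteq> X" "independent B" "X \<subseteq> span B" "card B = dim X" by (rule basis_exists)
  have fB: "finite B" using finite_dim_independent_finite[OF assms(2)] B assms(1) by auto
  have "Y \<subseteq> span B"
  proof (rule ccontr)
    assume "\<not> Y \<subseteq> span B"
    then obtain y where y: "y \<in> Y" "y \<notin> span B" by auto
    have "y \<notin> B" using y span_base by auto
    moreover have "independent (insert y B)" using y B by (simp add: independent_insertI)
    then have "card (insert y B) = dim (insert y B)" by (simp add: dim_eq_card_independent)
    moreover have "dim (insert y B) \<le> dim Y"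
      using y B assms by (intro dim_mono_finite_dim) auto
    ultimately show False using fB B assms(4) by simp
  qed
  moreover have "span B \<subseteq> X" using B(1) assms(3) by (simp add: span_minimal)
  ultimately show ?thesis using assms(1) by auto
qed

lemma dim_psubset_finite_dim:
  assumes "X \<subset> Y" "finite_dim scale Y" "subspace X"
  shows "dim X < dim Y"
  using subspace_dim_eq_finite_dim[of X Y] assms by (metis not_le psubset_eq)

end

section \<open>Rank-nullity\<close>

context vector_space_pair
begin

text \<open>A basis \<open>B\<close> of the kernel is extended to a basis \<open>C\<close> of
  \<open>X\<close>; since \<open>f\<close> is injective on the span of \<open>C - B\<close>, it maps
  \<open>C - B\<close> to a basis of the image.\<close>

lemma dim_image_plus_dim_kernel:
  assumes f: "Vector_Spaces.linear s1 s2 f" and X: "vs1.subspace X" and fd: "finite_dim s1 X"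
  shows "vs2.dim (f ` X) + vs1.dim {x \<in> X. f x = 0} = vs1.dim X"
proof -
  let ?K = "{x \<in> X. f x = 0}"
  obtain B where B: "B \<subseteq> ?K" "vs1.independent B" "?K \<subseteq> vs1.span B" "card B = vs1.dim ?K"
    by (rule vs1.basis_exists)
  obtain C where C: "B \<subseteq> C" "C \<subseteq> X" "vs1.independent C" "X \<subseteq> vs1.span C"
    using vs1.maximal_independent_subset_extend[of B X] B by blast
  have fC: "finite C" using vs1.finite_dim_independent_finite[OF fd C(2,3)] .
  have cC: "card C = vs1.dim X" using vs1.basis_card_eq_dim C by blast
  \<comment> \<open>A kernel vector in the span of \<open>C - B\<close> also lies in the span of
    \<open>B\<close>. Its coordinates with respect to \<open>C\<close> are supported in both sets,
    so they vanish.\<close>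
  have zero: "x = 0" if x: "x \<in> vs1.span (C - B)" "f x = 0" for x
  proof -
    have "x \<in> X" using x(1) C X by (meson Diff_subset subsetD subset_trans vs1.span_minimal)
    then have xB: "x \<in> vs1.span B" using x B by auto
    have "vs1.representation C x = vs1.representation B x"
      using vs1.representation_extend[OF C(3) xB C(1)] .
    moreover have "vs1.representation C x = vs1.representation (C - B) x"
      using vs1.representation_extend[OF C(3) x(1)] by auto
    ultimately have "vs1.representation C x b = 0" for b
      using vs1.representation_ne_zero[of B x b] vs1.representation_ne_zero[of "C - B" x b] by auto
    moreover have "(\<Sum>b | vs1.representation C x b \<noteq> 0. s1 (vs1.representation C x b) b) = x"
      using vs1.sum_nonzero_representation_eq[OF C(3)] C \<open>x \<in> X\<close> by auto
    ultimately show "x = 0" by simp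
  qed
  have inj: "inj_on f (vs1.span (C - B))"
    unfolding linear_inj_on_iff_eq_0[OF f vs1.subspace_span] using zero by blast
  have ind: "vs2.independent (f ` (C - B))"
    by (rule linear_independent_injective_image[OF f vs1.independent_mono[OF C(3)] inj]) auto
  have "f ` X \<subseteq> vs2.span (f ` (C - B))"
  proof -
    have "f ` X \<subseteq> f ` vs1.span C" using C(4) by (rule image_mono)
    also have "\<dots> = vs2.span (f ` C)" by (rule linear_span_image[OF f, symmetric])
    also have "\<dots> \<subseteq> vs2.span (insert 0 (f ` (C - B)))"
      by (rule vs2.span_mono) (use B in auto)
    finally show ?thesis by simp
  qed
  then have "card (f ` (C - B)) = vs2.dim (f ` X)"
    using ind C(2) by (intro vs2.basis_card_eq_dim) blast+
  moreover have "card (f ` (C - B)) = card C - card B"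
    using inj_on_subset[OF inj vs1.span_superset] fC C(1)
    by (simp add: card_image card_Diff_subset finite_subset)
  moreover have "card B \<le> card C" using C fC by (simp add: card_mono)
  ultimately show ?thesis using cC B by simp
qed

end

section \<open>Linear forms and their common kernels\<close>

context vector_space
begin

lemma vector_space_mult: "vector_space ((*) :: 'a \<Rightarrow> 'a \<Rightarrow> 'a)"
  by unfold_locales (auto simp: algebra_simps)

lemma subspace_common_kernel:
  assumes "\<And>i. i \<in> T \<Longrightarrow> Vector_Spaces.linear scale (*) (L i)" and "subspace X"
  shows "subspace {x \<in> X. \<forall>i\<in>T. L i x = 0}"
proof -
  have "L i 0 = 0" if "i \<in> T" for i
    using assms(1)[OF that] by (metis Vector_Spaces.linear_iff mult_zero_left scale_zero_left)
  then show ?thesis using assms unfolding subspace_def Vector_Spaces.linear_iff by auto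
qed

text \<open>The values of a form span at most a line, so by rank-nullity each further form lowers
  the dimension by at most 1.\<close>

lemma dim_le_dim_common_kernel:
  assumes "finite T" and "\<And>i. i \<in> T \<Longrightarrow> Vector_Spaces.linear scale (*) (L i)"
    and "subspace X" and "finite_dim scale X"
  shows "dim X \<le> dim {x \<in> X. \<forall>i\<in>T. L i x = 0} + card T"
  using assms(1,2)
proof (induction T rule: finite_induct)
  case empty
  then show ?case by simp
next
  case (insert i T)
  let ?Y = "{x \<in> X. \<forall>i\<in>T. L i x = 0}"
  interpret P: vector_space_pair scale "(*)"
    by (simp add: vector_space_pair_def vector_space_axioms vector_space_mult)
  have Y: "subspace ?Y" "finite_dim scale ?Y"
    using subspace_common_kernel[of T L X] insert.prems assms(3)
      finite_dim_subset[OF _ assms(4), of ?Y] by auto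
  have "P.vs2.dim (L i ` ?Y) \<le> card {1::'a}"
  proof (rule P.vs2.dim_le_card)
    show "L i ` ?Y \<subseteq> P.vs2.span {1}"
    proof
      fix c assume "c \<in> L i ` ?Y"
      show "c \<in> P.vs2.span {1}" using P.vs2.span_scale[OF P.vs2.span_base[of 1 "{1}"], of c] by simp
    qed
  qed simp
  moreover have "P.vs2.dim (L i ` ?Y) + dim {x \<in> ?Y. L i x = 0} = dim ?Y"
    by (rule P.dim_image_plus_dim_kernel) (use insert.prems Y in auto)
  moreover have "{x \<in> ?Y. L i x = 0} = {x \<in> X. \<forall>i\<in>insert i T. L i x = 0}" by auto
  moreover have "dim X \<le> dim ?Y + card T" using insert by auto
  ultimately show ?case using insert.hyps by simp
qed

text \<open>The vectors \<open>z q\<close> are dual to the forms up to nonzero factors. Hence the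
  kernels descend strictly: \<open>z m\<close> survives the forms below \<open>m\<close> but not
  \<open>L m\<close>.\<close>

lemma dim_common_kernel_le_dim:
  assumes lin: "\<And>q. q < m \<Longrightarrow> Vector_Spaces.linear scale (*) (L q)"
    and X: "subspace X" "finite_dim scale X"
    and z: "\<And>q. q < m \<Longrightarrow> z q \<in> X" "\<And>p q. p < m \<Longrightarrow> q < m \<Longrightarrow> L q (z p) = 0 \<longleftrightarrow> p \<noteq> q"
  shows "dim {x \<in> X. \<forall>q<m. L q x = 0} + m \<le> dim X"
  using lin z
proof (induction m)
  case 0
  then show ?case by simp
next
  case (Suc m)
  let ?Y = "{x \<in> X. \<forall>q<m. L q x = 0}"
  let ?Z = "{x \<in> X. \<forall>q<Suc m. L q x = 0}"
  have "?Z \<subset> ?Y"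
  proof
    show "?Z \<subseteq> ?Y" by auto
    have "z m \<in> ?Y" "z m \<notin> ?Z" using Suc.prems by auto
    then show "?Z \<noteq> ?Y" by auto
  qed
  moreover have "finite_dim scale ?Y" by (rule finite_dim_subset[OF _ X(2)]) auto
  moreover have "subspace ?Z"
    using subspace_common_kernel[of "{..<Suc m}" L X] Suc.prems X by (simp add: Ball_def)
  ultimately have "dim ?Z < dim ?Y" by (rule dim_psubset_finite_dim)
  moreover have "dim ?Y + m \<le> dim X" using Suc by auto
  ultimately show ?case by simp
qed

text \<open>The rows of the adjugate matrix combine the \<open>y p\<close> into vectors that are
  dual to the forms up to the common factor \<open>det\<close>.\<close>

lemma dim_common_kernel_le_dim_det:
  assumes lin: "\<And>q. q < m \<Longrightarrow> Vector_Spaces.linear scale (*) (L q)"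
    and X: "subspace X" "finite_dim scale X"
    and y: "\<And>p. p < m \<Longrightarrow> y p \<in> X"
    and det: "det (mat m m (\<lambda>(p, q). L q (y p))) \<noteq> 0"
  shows "dim {x \<in> X. \<forall>q<m. L q x = 0} + m \<le> dim X"
proof (rule dim_common_kernel_le_dim[where z = "\<lambda>j. \<Sum>p<m. scale (adj_mat (mat m m (\<lambda>(p, q). L q (y p))) $$ (j, p)) (y p)"])
  let ?M = "mat m m (\<lambda>(p, q). L q (y p))"
  fix j q assume j: "j < m" and q: "q < m"
  have L: "L q (x + x') = L q x + L q x'" "L q (scale c x) = c * L q x" for x x' c
    using lin[OF q] by (auto simp: Vector_Spaces.linear_iff)
  have L0: "L q 0 = 0" using L(2)[of 0 0] by simp
  have "L q (\<Sum>p\<in>A. scale (adj_mat ?M $$ (j, p)) (y p)) = (\<Sum>p\<in>A. adj_mat ?M $$ (j, p) * L q (y p))" for A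
    by (induction A rule: infinite_finite_induct) (auto simp: L L0)
  also have "(\<Sum>p<m. adj_mat ?M $$ (j, p) * L q (y p)) = (adj_mat ?M * ?M) $$ (j, q)"
    using j q adj_mat(1)[of ?M m] by (auto simp: scalar_prod_def atLeast0LessThan intro!: sum.cong)
  also have "\<dots> = (if j = q then det ?M else 0)" using j q adj_mat(3)[of ?M m] by auto
  finally show "(L q (\<Sum>p<m. scale (adj_mat ?M $$ (j, p)) (y p)) = 0) = (j \<noteq> q)" using det by auto
next
  fix j
  show "(\<Sum>p<m. scale (adj_mat (mat m m (\<lambda>(p, q). L q (y p))) $$ (j, p)) (y p)) \<in> X"
    using X y by (intro subspace_sum subspace_scale) auto
qed (use assms in auto)

text \<open>The forms other than \<open>L j\<close> lower the dimension by at most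
  \<open>card T - 1\<close>. So some vector of \<open>X\<close> is killed by all of them and not by
  \<open>L j\<close>, and it can be normalised.\<close>

lemma dual_system_if_dim_common_kernel:
  assumes T: "finite T" and lin: "\<And>i. i \<in> T \<Longrightarrow> Vector_Spaces.linear scale (*) (L i)"
    and X: "subspace X" "finite_dim scale X"
    and le: "dim {x \<in> X. \<forall>i\<in>T. L i x = 0} + card T \<le> dim X"
  obtains y where "\<And>j. j \<in> T \<Longrightarrow> y j \<in> X"
    and "\<And>i j. i \<in> T \<Longrightarrow> j \<in> T \<Longrightarrow> L i (y j) = (if i = j then 1 else 0)"
proof -
  have "\<exists>y\<in>X. \<forall>i\<in>T. L i y = (if i = j then 1 else 0)" if j: "j \<in> T" for j
  proof -
    have "dim X \<le> dim {x \<in> X. \<forall>i\<in>T-{j}. L i x = 0} + card (T-{j})"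
      by (rule dim_le_dim_common_kernel) (use T lin X in auto)
    moreover have "card T > 0" using T j card_gt_0_iff by blast
    ultimately have "{x \<in> X. \<forall>i\<in>T-{j}. L i x = 0} \<noteq> {x \<in> X. \<forall>i\<in>T. L i x = 0}"
      using le T j by auto
    then obtain x where x: "x \<in> X" "\<forall>i\<in>T-{j}. L i x = 0" "L j x \<noteq> 0" using j by blast
    have "\<forall>i\<in>T. L i (scale (1 / L j x) x) = (if i = j then 1 else 0)"
      using lin x by (auto simp: Vector_Spaces.linear_iff)
    moreover have "scale (1 / L j x) x \<in> X" using X x by (simp add: subspace_scale)
    ultimately show ?thesis by blast
  qed
  then show thesis using that by metis
qed

text \<open>This encodes a subspace of codimension at most 1 by a form. The last property gives both
  that zeros of \<open>g\<close> in \<open>U\<close> lie in \<open>N\<close> and that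
  \<open>u\<close> spans \<open>U\<close> modulo \<open>N\<close>.\<close>

lemma functional_with_kernel:
  assumes "subspace N" "subspace U" "finite_dim scale U" "N \<subseteq> U" "dim U \<le> dim N + 1"
  obtains g u where "Vector_Spaces.linear scale (*) g" "u \<in> U" "\<And>x. x \<in> N \<Longrightarrow> g x = 0"
    "N \<noteq> U \<Longrightarrow> g u = 1" "N = U \<Longrightarrow> g = (\<lambda>_. 0)" "\<And>x. x \<in> U \<Longrightarrow> x - scale (g x) u \<in> N"
proof (cases "N = U")
  case True
  show thesis
    by (rule that[of "\<lambda>_. 0" 0])
      (use assms True in \<open>auto simp: Vector_Spaces.linear_iff vector_space_mult vector_space_axioms subspace_0\<close>)
next
  case False
  then obtain u where u: "u \<in> U" "u \<notin> N" using assms(4) by auto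
  interpret P: vector_space_pair scale "(*)"
    by (simp add: vector_space_pair_def vector_space_axioms vector_space_mult)
  obtain B where B: "B \<subseteq> N" "independent B" "N \<subseteq> span B" "card B = dim N" by (rule basis_exists)
  have spB: "span B = N" using B assms(1) by (simp add: span_minimal subset_antisym)
  have fB: "finite B" using finite_dim_independent_finite[OF assms(3)] B assms by auto
  have ind: "independent (insert u B)" using u B spB by (simp add: independent_insertI)
  obtain g where g: "Vector_Spaces.linear scale (*) g" "\<forall>x\<in>insert u B. g x = (if x = u then 1 else 0)"
    using P.linear_independent_extend[OF ind, of "\<lambda>x. if x = u then 1 else 0"] by blast
  have gN: "g x = 0" if "x \<in> N" for x
  proof (rule P.linear_eq_0_on_span[OF g(1)])
    show "x \<in> span B" using that spB by simp
    show "g b = 0" if "b \<in> B" for b using g(2) that B(1) u(2) by auto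
  qed
  have "dim (span (insert u B)) = dim N + 1"
    using ind fB u(2) B(1,4) by (subst dim_span_eq_card_independent) (auto simp: card_insert_if)
  moreover have "span (insert u B) \<subseteq> U"
    by (rule span_minimal) (use B u assms in auto)
  ultimately have "span (insert u B) = U"
    using assms by (intro subspace_dim_eq_finite_dim) auto
  have "x - scale (g x) u \<in> N" if x: "x \<in> U" for x
  proof -
    obtain k where k: "x - scale k u \<in> span B"
      using x \<open>span (insert u B) = U\<close> span_breakdown_eq by blast
    then have "g (x - scale k u) = 0" using gN spB by auto
    moreover have "g (x - scale k u) = g x - k * g u"
      using P.linear_diff[OF g(1)] g(1) by (simp add: Vector_Spaces.linear_iff)
    ultimately have "g x = k" using g(2) by simp
    then show ?thesis using k spB by simp
  qed
  then show thesis using that[of g u] g gN u False by auto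
qed

end


section \<open>Multihomogeneous polynomials\<close>

lemma poly_mapping_eq_sum_single: "p = (\<Sum>m\<in>Poly_Mapping.keys p. Poly_Mapping.single m (Poly_Mapping.lookup p m))"
  by (rule poly_mapping_eqI)
    (auto simp: lookup_sum lookup_single when_def in_keys_iff)

lemma poly_mapping_mult_eq_sum_single:
  "f * g = (\<Sum>a\<in>Poly_Mapping.keys f. \<Sum>b\<in>Poly_Mapping.keys g.
     Poly_Mapping.single (a + b) (Poly_Mapping.lookup f a * Poly_Mapping.lookup g b))"
proof -
  have "f * g = (\<Sum>a\<in>Poly_Mapping.keys f. Poly_Mapping.single a (Poly_Mapping.lookup f a)) *
      (\<Sum>b\<in>Poly_Mapping.keys g. Poly_Mapping.single b (Poly_Mapping.lookup g b))"
    using poly_mapping_eq_sum_single[of f] poly_mapping_eq_sum_single[of g] by simp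
  then show ?thesis by (simp add: sum_product mult_single)
qed

definition monom_eval :: "('x \<Rightarrow>\<^sub>0 nat) \<Rightarrow> ('x \<Rightarrow> 'k::comm_semiring_1) \<Rightarrow> 'k" where
  "monom_eval m c = (\<Prod>x\<in>Poly_Mapping.keys m. c x ^ Poly_Mapping.lookup m x)"

text \<open>Extra variables have exponent 0. This puts several monomials over one index set.\<close>

lemma monom_eval_superset:
  assumes "finite X" "Poly_Mapping.keys m \<subseteq> X"
  shows "monom_eval m c = (\<Prod>x\<in>X. c x ^ Poly_Mapping.lookup m x)"
  unfolding monom_eval_def
  by (rule prod.mono_neutral_left) (use assms in \<open>auto simp: in_keys_iff\<close>)

lemma monom_eval_add: "monom_eval (a + b) c = monom_eval a c * monom_eval b c"
proof -
  let ?X = "Poly_Mapping.keys a \<union> Poly_Mapping.keys b"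
  show ?thesis
    using monom_eval_superset[of ?X a c] monom_eval_superset[of ?X b c] monom_eval_superset[of ?X "a + b" c]
    by (simp add: keys_add lookup_add power_add prod.distrib)
qed

lemma poly_eval_superset:
  assumes "finite M" "Poly_Mapping.keys f \<subseteq> M"
  shows "poly_eval f c = (\<Sum>m\<in>M. Poly_Mapping.lookup f m * monom_eval m c)"
  unfolding poly_eval_def monom_eval_def[symmetric]
  by (rule sum.mono_neutral_left) (use assms in \<open>auto simp: in_keys_iff\<close>)

lemma poly_eval_0 [simp]: "poly_eval 0 c = 0"
  by (simp add: poly_eval_def)

lemma poly_eval_add: "poly_eval (f + g) c = poly_eval f c + poly_eval g c"
proof -
  let ?M = "Poly_Mapping.keys f \<union> Poly_Mapping.keys g"
  show ?thesis
    using poly_eval_superset[of ?M f c] poly_eval_superset[of ?M g c] poly_eval_superset[of ?M "f + g" c]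
    by (simp add: keys_add lookup_add sum.distrib distrib_right)
qed

lemma poly_eval_sum: "poly_eval (sum f A) c = (\<Sum>a\<in>A. poly_eval (f a) c)"
  by (induction A rule: infinite_finite_induct) (simp_all add: poly_eval_add)

lemma poly_eval_single: "poly_eval (Poly_Mapping.single m a) c = a * monom_eval m c"
  by (simp add: poly_eval_def monom_eval_def)

lemma poly_eval_mult: "poly_eval (f * g) c = poly_eval f c * poly_eval g c"
proof -
  have "poly_eval (f * g) c = (\<Sum>a\<in>Poly_Mapping.keys f. \<Sum>b\<in>Poly_Mapping.keys g.
      (Poly_Mapping.lookup f a * monom_eval a c) * (Poly_Mapping.lookup g b * monom_eval b c))"
    by (subst poly_mapping_mult_eq_sum_single)
      (simp add: poly_eval_sum poly_eval_single monom_eval_add ac_simps)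
  then show ?thesis by (simp add: sum_product poly_eval_def monom_eval_def)
qed

lemma poly_eval_1: "poly_eval 1 c = 1"
  by (simp add: poly_eval_def)

text \<open>This lets evaluation pass through the determinant of a matrix of polynomials.\<close>

lemma comm_ring_hom_poly_eval: "comm_ring_hom (\<lambda>f. poly_eval f (c :: 'x \<Rightarrow> 'k::comm_ring_1))"
  by unfold_locales (simp_all add: poly_eval_add poly_eval_mult poly_eval_1)

text \<open>Exponents become digits. A new variable \<open>y\<close> gets a weight \<open>B\<close>
  above all old weighted sums on \<open>M\<close>, so division by \<open>B\<close> recovers the
  exponent of \<open>y\<close> and leaves the old sum as remainder.\<close>

lemma separating_weight:
  fixes M :: "('x \<Rightarrow>\<^sub>0 nat) set"
  assumes "finite X" "finite M"
  obtains w :: "'x \<Rightarrow> nat" where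
    "\<And>m m'. m \<in> M \<Longrightarrow> m' \<in> M \<Longrightarrow>
       (\<Sum>x\<in>X. Poly_Mapping.lookup m x * w x) = (\<Sum>x\<in>X. Poly_Mapping.lookup m' x * w x) \<Longrightarrow>
       \<forall>x\<in>X. Poly_Mapping.lookup m x = Poly_Mapping.lookup m' x"
proof -
  have "\<exists>w :: 'x \<Rightarrow> nat. \<forall>m\<in>M. \<forall>m'\<in>M.
       (\<Sum>x\<in>X. Poly_Mapping.lookup m x * w x) = (\<Sum>x\<in>X. Poly_Mapping.lookup m' x * w x) \<longrightarrow>
       (\<forall>x\<in>X. Poly_Mapping.lookup m x = Poly_Mapping.lookup m' x)"
    using assms(1)
  proof (induction X rule: finite_induct)
    case empty
    then show ?case by simp
  next
    case (insert y X)
    then obtain w :: "'x \<Rightarrow> nat" where w: "\<forall>m\<in>M. \<forall>m'\<in>M.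
       (\<Sum>x\<in>X. Poly_Mapping.lookup m x * w x) = (\<Sum>x\<in>X. Poly_Mapping.lookup m' x * w x) \<longrightarrow>
       (\<forall>x\<in>X. Poly_Mapping.lookup m x = Poly_Mapping.lookup m' x)" by blast
    define h where "h m = (\<Sum>x\<in>X. Poly_Mapping.lookup m x * w x)" for m :: "'x \<Rightarrow>\<^sub>0 nat"
    define B where "B = Suc (\<Sum>m\<in>M. h m)"
    have hB: "h m < B" if "m \<in> M" for m
      using member_le_sum[of m M h] that assms(2) by (simp add: B_def less_Suc_eq_le)
    have h': "(\<Sum>x\<in>insert y X. Poly_Mapping.lookup m x * (w(y := B)) x) = Poly_Mapping.lookup m y * B + h m" for m
    proof -
      have "(\<Sum>x\<in>X. Poly_Mapping.lookup m x * (w(y := B)) x) = h m"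
        unfolding h_def using insert.hyps by (intro sum.cong) auto
      then show ?thesis using insert.hyps by simp
    qed
    show ?case
    proof (intro exI[of _ "w(y := B)"] ballI impI, unfold h')
      fix m m' x
      assume m: "m \<in> M" "m' \<in> M" and x: "x \<in> insert y X"
        and eq: "Poly_Mapping.lookup m y * B + h m = Poly_Mapping.lookup m' y * B + h m'"
      have "(Poly_Mapping.lookup m y * B + h m) div B = Poly_Mapping.lookup m y" using hB[OF m(1)] by simp
      moreover have "(Poly_Mapping.lookup m' y * B + h m') div B = Poly_Mapping.lookup m' y" using hB[OF m(2)] by simp
      ultimately have "Poly_Mapping.lookup m y = Poly_Mapping.lookup m' y" using eq by simp
      moreover from this eq have "h m = h m'" by simp
      ultimately show "Poly_Mapping.lookup m x = Poly_Mapping.lookup m' x"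
        using w m x unfolding h_def by blast
    qed
  qed
  then show thesis using that by blast
qed

text \<open>The variables carry no linear order, so the integral domain instance of \<^typ>\<open>'a \<Rightarrow>\<^sub>0 'b\<close> does
  not apply. A weight that separates the finitely many monomials involved yields leading terms.\<close>

lemma poly_mult_nonzero:
  fixes f g :: "('x \<Rightarrow>\<^sub>0 nat) \<Rightarrow>\<^sub>0 'k::idom"
  assumes "f \<noteq> 0" "g \<noteq> 0"
  shows "f * g \<noteq> 0"
proof -
  define M where "M = Poly_Mapping.keys f \<union> Poly_Mapping.keys g"
  define X where "X = (\<Union>m\<in>M. Poly_Mapping.keys m)"
  have fin: "finite M" "finite X" by (auto simp: M_def X_def)
  obtain w :: "'x \<Rightarrow> nat" where w: "\<And>m m'. m \<in> M \<Longrightarrow> m' \<in> M \<Longrightarrow>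
       (\<Sum>x\<in>X. Poly_Mapping.lookup m x * w x) = (\<Sum>x\<in>X. Poly_Mapping.lookup m' x * w x) \<Longrightarrow>
       \<forall>x\<in>X. Poly_Mapping.lookup m x = Poly_Mapping.lookup m' x"
    using separating_weight[OF fin(2,1)] by blast
  define h where "h m = (\<Sum>x\<in>X. Poly_Mapping.lookup m x * w x)" for m :: "'x \<Rightarrow>\<^sub>0 nat"
  have h_add: "h (a + b) = h a + h b" for a b
    by (simp add: h_def lookup_add distrib_right sum.distrib)
  have inj: "m = m'" if "m \<in> M" "m' \<in> M" "h m = h m'" for m m'
  proof (rule poly_mapping_eqI)
    fix x
    show "Poly_Mapping.lookup m x = Poly_Mapping.lookup m' x"
    proof (cases "x \<in> X")
      case True
      then show ?thesis using w[OF that(1,2)] that(3) unfolding h_def by blast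
    next
      case False
      then have "x \<notin> Poly_Mapping.keys m" "x \<notin> Poly_Mapping.keys m'" using that by (auto simp: X_def)
      then show ?thesis by (simp add: in_keys_iff)
    qed
  qed
  have "\<exists>a\<in>Poly_Mapping.keys p. \<forall>b\<in>Poly_Mapping.keys p. h b \<le> h a" if "p \<noteq> 0" for p :: "('x \<Rightarrow>\<^sub>0 nat) \<Rightarrow>\<^sub>0 'k"
  proof -
    have "Max (h ` Poly_Mapping.keys p) \<in> h ` Poly_Mapping.keys p" using that by (intro Max_in) auto
    then obtain a where "a \<in> Poly_Mapping.keys p" "h a = Max (h ` Poly_Mapping.keys p)" by auto
    then show ?thesis by (intro bexI[of _ a]) auto
  qed
  then obtain a b where a: "a \<in> Poly_Mapping.keys f" "\<And>a'. a' \<in> Poly_Mapping.keys f \<Longrightarrow> h a' \<le> h a"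
    and b: "b \<in> Poly_Mapping.keys g" "\<And>b'. b' \<in> Poly_Mapping.keys g \<Longrightarrow> h b' \<le> h b"
    using assms by meson
  \<comment> \<open>As \<open>h\<close> is additive and injective on \<open>M\<close>, and
    \<open>a\<close>, \<open>b\<close> are heaviest, no other pair of monomials has the product
    \<open>a + b\<close>.\<close>
  have lead: "a' = a \<and> b' = b"
    if "a' \<in> Poly_Mapping.keys f" "b' \<in> Poly_Mapping.keys g" "a' + b' = a + b" for a' b'
  proof -
    have "h a' + h b' = h a + h b" using that h_add by metis
    then have "h a' = h a" "h b' = h b" using a(2)[OF that(1)] b(2)[OF that(2)] by auto
    then show ?thesis using inj that a b by (auto simp: M_def)
  qed
  have "Poly_Mapping.lookup (f * g) (a + b) = (\<Sum>a'\<in>Poly_Mapping.keys f. \<Sum>b'\<in>Poly_Mapping.keys g.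
      if a' + b' = a + b then Poly_Mapping.lookup f a' * Poly_Mapping.lookup g b' else 0)"
    by (subst poly_mapping_mult_eq_sum_single) (simp add: lookup_sum lookup_single when_def)
  also have "\<dots> = (\<Sum>a'\<in>Poly_Mapping.keys f. if a' = a then
      (\<Sum>b'\<in>Poly_Mapping.keys g. if b' = b then Poly_Mapping.lookup f a * Poly_Mapping.lookup g b else 0) else 0)"
    by (intro sum.cong refl) (use lead in \<open>auto intro!: sum.cong sum.neutral\<close>)
  also have "\<dots> = Poly_Mapping.lookup f a * Poly_Mapping.lookup g b"
    using a(1) b(1) by simp
  finally have "Poly_Mapping.lookup (f * g) (a + b) \<noteq> 0" using a(1) b(1) by (simp add: in_keys_iff)
  then show ?thesis by auto
qed

text \<open>The multidegree is a parameter here because sums need equal multidegrees and products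
  add them.\<close>

definition multihomogeneous_deg ::
    "'i set \<Rightarrow> ('i \<Rightarrow> 'w set) \<Rightarrow> ('i \<Rightarrow> nat) \<Rightarrow> (('i \<times> 'w \<Rightarrow>\<^sub>0 nat) \<Rightarrow>\<^sub>0 'k::zero) \<Rightarrow> bool" where
  "multihomogeneous_deg A E deg f \<longleftrightarrow> (\<forall>m\<in>Poly_Mapping.keys f.
     Poly_Mapping.keys m \<subseteq> Sigma A E \<and>
     (\<forall>i\<in>A. (\<Sum>e\<in>E i. Poly_Mapping.lookup m (i, e)) = deg i))"

lemma multihomogeneous_iff_deg: "multihomogeneous A E f \<longleftrightarrow> (\<exists>deg. multihomogeneous_deg A E deg f)"
  by (simp add: multihomogeneous_def multihomogeneous_deg_def)

lemma multihomogeneous_deg_0: "multihomogeneous_deg A E deg 0"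
  by (simp add: multihomogeneous_deg_def)

lemma multihomogeneous_deg_1: "multihomogeneous_deg A E (\<lambda>_. 0) (1 :: _ \<Rightarrow>\<^sub>0 'k::zero_neq_one)"
  by (simp add: multihomogeneous_deg_def)

lemma multihomogeneous_deg_uminus:
  "multihomogeneous_deg A E deg f \<Longrightarrow> multihomogeneous_deg A E deg (- f :: _ \<Rightarrow>\<^sub>0 'k::ab_group_add)"
  by (simp add: multihomogeneous_deg_def)

lemma multihomogeneous_deg_add:
  "multihomogeneous_deg A E deg f \<Longrightarrow> multihomogeneous_deg A E deg g \<Longrightarrow>
   multihomogeneous_deg A E deg (f + g :: _ \<Rightarrow>\<^sub>0 'k::monoid_add)"
  using keys_add[of f g] unfolding multihomogeneous_deg_def by blast

lemma multihomogeneous_deg_sum: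
  "(\<And>s. s \<in> S \<Longrightarrow> multihomogeneous_deg A E deg (f s)) \<Longrightarrow>
   multihomogeneous_deg A E deg (sum f S :: _ \<Rightarrow>\<^sub>0 'k::comm_monoid_add)"
  by (induction S rule: infinite_finite_induct)
    (simp_all add: multihomogeneous_deg_0 multihomogeneous_deg_add)

lemma multihomogeneous_deg_mult:
  assumes "multihomogeneous_deg A E deg f" "multihomogeneous_deg A E deg' g"
  shows "multihomogeneous_deg A E (\<lambda>i. deg i + deg' i) (f * g :: _ \<Rightarrow>\<^sub>0 'k::semiring_0)"
  unfolding multihomogeneous_deg_def
proof
  fix m assume "m \<in> Poly_Mapping.keys (f * g)"
  then obtain a b where m: "m = a + b" "a \<in> Poly_Mapping.keys f" "b \<in> Poly_Mapping.keys g"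
    using keys_mult by blast
  then have "Poly_Mapping.keys m \<subseteq> Sigma A E"
    using assms keys_add[of a b] unfolding multihomogeneous_deg_def by blast
  then show "Poly_Mapping.keys m \<subseteq> Sigma A E \<and>
      (\<forall>i\<in>A. (\<Sum>e\<in>E i. Poly_Mapping.lookup m (i, e)) = deg i + deg' i)"
    using assms m unfolding multihomogeneous_deg_def by (simp add: lookup_add sum.distrib)
qed

lemma multihomogeneous_deg_prod:
  "(\<And>s. s \<in> S \<Longrightarrow> multihomogeneous_deg A E (deg s) (f s)) \<Longrightarrow>
   multihomogeneous_deg A E (\<lambda>i. \<Sum>s\<in>S. deg s i) (prod f S :: _ \<Rightarrow>\<^sub>0 'k::comm_semiring_1)"
  by (induction S rule: infinite_finite_induct)
    (simp_all add: multihomogeneous_deg_1 multihomogeneous_deg_mult)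

lemma multihomogeneous_deg_linear_monom:
  assumes "(i, e) \<in> Sigma A E" "finite (E i)"
  shows "multihomogeneous_deg A E (\<lambda>j. if j = i then 1 else 0)
    (Poly_Mapping.single (Poly_Mapping.single (i, e) 1) a)"
proof -
  have "(\<Sum>e'\<in>E j. Poly_Mapping.lookup (Poly_Mapping.single (i, e) (1::nat)) (j, e')) = (if j = i then 1 else 0)" for j
    using assms by (auto simp: lookup_single when_def)
  then show ?thesis using assms by (auto simp: multihomogeneous_deg_def)
qed

text \<open>All entries of column \<open>q\<close> share the multidegree \<open>deg q\<close>. Each
  term of the Leibniz formula takes one entry from every column, so all terms have the same total
  multidegree.\<close>

lemma multihomogeneous_deg_det:
  fixes f :: "nat \<Rightarrow> nat \<Rightarrow> ('i \<times> 'w \<Rightarrow>\<^sub>0 nat) \<Rightarrow>\<^sub>0 'k::comm_ring_1"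
  assumes "\<And>p q. p < m \<Longrightarrow> q < m \<Longrightarrow> multihomogeneous_deg A E (deg q) (f p q)"
  shows "multihomogeneous_deg A E (\<lambda>i. \<Sum>q<m. deg q i) (det (mat m m (\<lambda>(p, q). f p q)))"
proof -
  have "multihomogeneous_deg A E (\<lambda>i. \<Sum>q<m. deg q i)
      (signof \<pi> * (\<Prod>p = 0..<m. f p (\<pi> p)))" if \<pi>: "\<pi> permutes {0..<m}" for \<pi>
  proof -
    have "multihomogeneous_deg A E (\<lambda>i. \<Sum>p\<in>{0..<m}. deg (\<pi> p) i) (\<Prod>p = 0..<m. f p (\<pi> p))"
      by (rule multihomogeneous_deg_prod) (use assms permutes_in_image[OF \<pi>] in auto)
    moreover have "(\<lambda>i. \<Sum>p\<in>{0..<m}. deg (\<pi> p) i) = (\<lambda>i. \<Sum>q<m. deg q i)"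
    proof
      fix i
      show "(\<Sum>p\<in>{0..<m}. deg (\<pi> p) i) = (\<Sum>q<m. deg q i)"
        using sum.permute[OF \<pi>, of "\<lambda>q. deg q i"] by (simp add: comp_def atLeast0LessThan)
    qed
    ultimately show ?thesis by (auto simp: sign_def multihomogeneous_deg_uminus)
  qed
  moreover have "det (mat m m (\<lambda>(p, q). f p q)) =
      (\<Sum>\<pi> | \<pi> permutes {0..<m}. signof \<pi> * (\<Prod>p = 0..<m. f p (\<pi> p)))"
    by (subst det_def'[of _ m])
      (auto intro!: sum.cong prod.cong simp: permutes_in_image)
  ultimately show ?thesis by (auto intro: multihomogeneous_deg_sum)
qed

text \<open>Finitely many nonempty open conditions are combined by multiplying their polynomials.
  Nonemptiness is the polynomial being nonzero, so the argument also covers finite fields.\<close>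

lemma multihomogeneous_product:
  fixes Q :: "'s \<Rightarrow> (('i \<times> 'w \<Rightarrow> 'k::field) \<Rightarrow> bool)"
  assumes "finite S"
    and "\<And>s. s \<in> S \<Longrightarrow> \<exists>f. multihomogeneous A E f \<and> f \<noteq> 0 \<and> (\<forall>c. poly_eval f c \<noteq> 0 \<longrightarrow> Q s c)"
  shows "\<exists>f. multihomogeneous A E f \<and> f \<noteq> 0 \<and> (\<forall>c. poly_eval f c \<noteq> 0 \<longrightarrow> (\<forall>s\<in>S. Q s c))"
  using assms
proof (induction S rule: finite_induct)
  case empty
  then show ?case
    unfolding multihomogeneous_iff_deg
    by (intro exI[of _ 1] conjI exI[of _ "\<lambda>_. 0"] multihomogeneous_deg_1) simp_all
next
  case (insert s S)
  obtain f where f: "multihomogeneous A E f" "f \<noteq> 0" "\<forall>c. poly_eval f c \<noteq> 0 \<longrightarrow> Q s c"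
    using insert.prems by blast
  obtain g where g: "multihomogeneous A E g" "g \<noteq> 0" "\<forall>c. poly_eval g c \<noteq> 0 \<longrightarrow> (\<forall>s\<in>S. Q s c)"
    using insert.IH insert.prems by blast
  have "multihomogeneous A E (f * g)"
    using f(1) g(1) multihomogeneous_deg_mult unfolding multihomogeneous_iff_deg by blast
  moreover have "f * g \<noteq> 0" using f(2) g(2) by (rule poly_mult_nonzero)
  ultimately show ?case using f(3) g(3)
    by (intro exI[of _ "f * g"]) (auto simp: poly_eval_mult)
qed


section \<open>Rado's theorem for polymatroids\<close>

text \<open>The inequality is strict exactly when \<open>J\<close> lies in the union but in neither
  of the two sets; this drives the uncrossing in Rado's theorem.\<close>

lemma xi_submodular: "xi J (K \<union> K') + xi J (K \<inter> K') \<le> xi J K + xi J K'"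
  by (auto simp: xi_def)

text \<open>The sets \<open>J i\<close> are shrunk as long as the bound survives. In a minimal
  family every set is empty or a singleton, and the singletons give \<open>T\<close> and
  \<open>v\<close>.\<close>

lemma defect_Rado_polymatroid:
  fixes \<phi> :: "'v set \<Rightarrow> int" and J :: "'i \<Rightarrow> 'v set"
  assumes V: "finite V" and A: "finite A" and JV: "\<And>i. i \<in> A \<Longrightarrow> J i \<subseteq> V"
    and submod: "\<And>K K'. K \<subseteq> V \<Longrightarrow> K' \<subseteq> V \<Longrightarrow> \<phi> (K \<union> K') + \<phi> (K \<inter> K') \<le> \<phi> K + \<phi> K'"
    and nonneg: "\<And>K. K \<subseteq> V \<Longrightarrow> 0 \<le> \<phi> K" and empty: "\<phi> {} = 0"
    and bound: "\<And>K. K \<subseteq> V \<Longrightarrow> int m \<le> \<phi> K + int (card A) + (\<Sum>i\<in>A. xi (J i) K)"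
  obtains T v where "T \<subseteq> A" "card T = m" "\<And>i. i \<in> T \<Longrightarrow> v i \<in> J i"
    "\<And>K. K \<subseteq> V \<Longrightarrow> 0 \<le> \<phi> K + (\<Sum>i\<in>T. xi {v i} K)"
proof -
  \<comment> \<open>\<open>g J K\<close> is \<open>\<phi> K\<close> plus the number of
    \<open>i \<in> A\<close> with \<open>J i\<close> not contained in \<open>K\<close>; the bound
    says that it is at least \<open>m\<close>.\<close>
  define g where "g J K = \<phi> K + int (card A) + (\<Sum>i\<in>A. xi (J i) K)" for J K
  define P where "P J' \<longleftrightarrow> (\<forall>i\<in>A. J' i \<subseteq> J i) \<and> (\<forall>K\<subseteq>V. int m \<le> g J' K)" for J'
  define \<mu> where "\<mu> J' = (\<Sum>i\<in>A. card (J' i))" for J' :: "'i \<Rightarrow> 'v set"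
  have "P J" using bound by (simp add: P_def g_def)
  then obtain J' where J': "P J'" and least: "\<And>J''. P J'' \<Longrightarrow> \<mu> J' \<le> \<mu> J''"
    using ex_has_least_nat[of P J \<mu>] by blast
  have JJ: "J' i \<subseteq> J i" "finite (J' i)" if "i \<in> A" for i
  proof -
    show "J' i \<subseteq> J i" using J' that by (simp add: P_def)
    then show "finite (J' i)" using JV[OF that] V by (meson finite_subset)
  qed
  have ge: "int m \<le> g J' K" if "K \<subseteq> V" for K using J' that by (auto simp: P_def)
  have g_submod: "g J' (K \<union> K') + g J' (K \<inter> K') \<le> g J' K + g J' K'" if "K \<subseteq> V" "K' \<subseteq> V" for K K'
  proof -
    have "(\<Sum>i\<in>A. xi (J' i) (K \<union> K') + xi (J' i) (K \<inter> K')) \<le> (\<Sum>i\<in>A. xi (J' i) K + xi (J' i) K')"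
      by (intro sum_mono xi_submodular)
    then show ?thesis using submod[OF that] by (simp add: g_def sum.distrib)
  qed
  \<comment> \<open>By minimality, deleting \<open>x\<close> breaks the bound at some
    \<open>K\<close>. Only the term of \<open>i\<close> changes, and only by 1, so
    \<open>g J' K = m\<close> and \<open>x\<close> is the one element of \<open>J' i\<close> outside
    \<open>K\<close>.\<close>
  have tight: "\<exists>K\<subseteq>V. g J' K = int m \<and> x \<notin> K \<and> J' i - {x} \<subseteq> K" if i: "i \<in> A" and x: "x \<in> J' i" for i x
  proof -
    let ?J = "J'(i := J' i - {x})"
    have "\<mu> ?J < \<mu> J'" unfolding \<mu>_def
    proof (rule sum_strict_mono_ex1)
      show "\<forall>j\<in>A. card (?J j) \<le> card (J' j)" by (simp add: card_Diff1_le)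
      show "\<exists>j\<in>A. card (?J j) < card (J' j)"
        using i x JJ(2) by (intro bexI[of _ i]) (simp_all only: fun_upd_same card_Diff1_less)
    qed (rule A)
    then have "\<not> P ?J" using least not_le by blast
    moreover have "\<forall>j\<in>A. ?J j \<subseteq> J j" using JJ(1) by auto
    ultimately have "\<not> (\<forall>K\<subseteq>V. int m \<le> g ?J K)" unfolding P_def by blast
    then obtain K where K: "K \<subseteq> V" "g ?J K < int m" by auto
    have eq: "g J K = \<phi> K + int (card A) + (\<Sum>j\<in>A-{i}. xi (J j) K) + xi (J i) K" for J
      using A i by (simp add: g_def sum.remove)
    have "(\<Sum>j\<in>A-{i}. xi (?J j) K) = (\<Sum>j\<in>A-{i}. xi (J' j) K)" by (rule sum.cong) auto
    then have "g ?J K = g J' K - xi (J' i) K + xi (J' i - {x}) K" using eq[of ?J] eq[of J'] by simp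
    then have "xi (J' i - {x}) K < xi (J' i) K" "g J' K = int m"
      using K ge[of K] by (auto simp: xi_def split: if_splits)
    then show ?thesis using K(1) by (auto simp: xi_def split: if_splits)
  qed
  \<comment> \<open>Tight sets missing only \<open>x\<close> and only \<open>x'\<close> have a union
    that contains \<open>J' i\<close>, while neither contains it. Submodularity is then strict, and
    union or intersection violates the bound.\<close>
  have single: "x = x'" if i: "i \<in> A" and x: "x \<in> J' i" "x' \<in> J' i" for i x x'
  proof (rule ccontr)
    assume "x \<noteq> x'"
    obtain K where K: "K \<subseteq> V" "g J' K = int m" "x \<notin> K" "J' i - {x} \<subseteq> K" using tight[OF i x(1)] by metis
    obtain K' where K': "K' \<subseteq> V" "g J' K' = int m" "x' \<notin> K'" "J' i - {x'} \<subseteq> K'" using tight[OF i x(2)] by metis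
    have "(\<Sum>j\<in>A. xi (J' j) (K \<union> K') + xi (J' j) (K \<inter> K')) < (\<Sum>j\<in>A. xi (J' j) K + xi (J' j) K')"
    proof (rule sum_strict_mono_ex1)
      show "\<exists>j\<in>A. xi (J' j) (K \<union> K') + xi (J' j) (K \<inter> K') < xi (J' j) K + xi (J' j) K'"
      proof (rule bexI[OF _ i])
        have "\<not> J' i \<subseteq> K" "\<not> J' i \<subseteq> K'" using x K(3) K'(3) by blast+
        moreover have "J' i \<subseteq> K \<union> K'" using K(4) K'(4) \<open>x \<noteq> x'\<close> by blast
        ultimately show "xi (J' i) (K \<union> K') + xi (J' i) (K \<inter> K') < xi (J' i) K + xi (J' i) K'"
          by (simp add: xi_def)
      qed
    qed (use A xi_submodular in auto)
    then have "g J' (K \<union> K') + g J' (K \<inter> K') < g J' K + g J' K'"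
      using submod[OF K(1) K'(1)] by (simp add: g_def sum.distrib)
    then show False using ge[of "K \<union> K'"] ge[of "K \<inter> K'"] K K' by auto
  qed
  define T where "T = {i \<in> A. J' i \<noteq> {}}"
  define v where "v i = (SOME x. x \<in> J' i)" for i
  have v: "v i \<in> J' i" if "i \<in> T" for i using that unfolding T_def v_def by (auto intro: someI)
  have J'v: "J' i = {v i}" if "i \<in> T" for i 
  proof -
    have "i \<in> A" using that by (simp add: T_def)
    show ?thesis using v[OF that] by (intro equalityI subsetI) (auto dest: single[OF \<open>i \<in> A\<close> v[OF that]])
  qed
  have T: "T \<subseteq> A" "finite T" using A by (auto simp: T_def)
  \<comment> \<open>Outside \<open>T\<close> the set \<open>J' i\<close> is empty and
    \<open>xi\<close> is constantly -1, which cancels against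
    \<open>card A - card T\<close>.\<close>
  have gT: "g J' K = \<phi> K + int (card T) + (\<Sum>i\<in>T. xi {v i} K)" for K
  proof -
    have "(\<Sum>i\<in>A. xi (J' i) K) = (\<Sum>i\<in>T. xi (J' i) K) + (\<Sum>i\<in>A-T. xi (J' i) K)"
      using T A by (metis add.commute sum.subset_diff)
    also have "(\<Sum>i\<in>A-T. xi (J' i) K) = - int (card (A - T))" by (simp add: T_def xi_def)
    also have "(\<Sum>i\<in>T. xi (J' i) K) = (\<Sum>i\<in>T. xi {v i} K)" by (intro sum.cong refl) (simp add: J'v)
    finally show ?thesis
      using T A card_mono[OF A T(1)] by (simp add: g_def card_Diff_subset of_nat_diff)
  qed
  \<comment> \<open>Tight sets are closed under intersection, by submodularity of
    \<open>g J'\<close>. Intersecting those for the single \<open>v i\<close> yields a tight set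
    that avoids all of them; there \<open>m = \<phi> K + card T\<close>.\<close>
  have "\<exists>K\<subseteq>V. g J' K = int m \<and> (\<forall>i\<in>S. v i \<notin> K)" if "finite S" "S \<noteq> {}" "S \<subseteq> T" for S
    using that
  proof (induction S rule: finite_ne_induct)
    case (singleton i)
    then have "i \<in> A" "v i \<in> J' i" using v T(1) by auto
    from tight[OF this] show ?case by auto
  next
    case (insert i S)
    obtain K where K: "K \<subseteq> V" "g J' K = int m" "\<forall>i\<in>S. v i \<notin> K"
      using insert.IH insert.prems by auto
    have i: "i \<in> A" "v i \<in> J' i" using v T(1) insert.prems by auto
    obtain K' where K': "K' \<subseteq> V" "g J' K' = int m" "v i \<notin> K'"
      using tight[OF i] by metis
    have "g J' (K \<inter> K') = int m"
      using g_submod[OF K(1) K'(1)] ge[of "K \<union> K'"] ge[OF le_infI1[OF K(1)], of K'] K K' by auto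
    then show ?case using K K' by (intro exI[of _ "K \<inter> K'"]) auto
  qed
  note tightT = this[OF T(2) _ order_refl]
  have "card T \<le> m"
  proof (cases "T = {}")
    case False
    then obtain K where K: "K \<subseteq> V" "g J' K = int m" "\<forall>i\<in>T. v i \<notin> K" using tightT by metis
    have "(\<Sum>i\<in>T. xi {v i} K) = 0" using K by (intro sum.neutral) (auto simp: xi_def)
    then show ?thesis using K(2) gT[of K] nonneg[OF K(1)] by simp
  qed simp
  \<comment> \<open>At the empty set \<open>g J'\<close> equals \<open>card T\<close>, because
    \<open>\<phi> {} = 0\<close>.\<close>
  moreover have "m \<le> card T"
  proof -
    have "(\<Sum>i\<in>T. xi {v i} {}) = 0" by (intro sum.neutral) (auto simp: xi_def)
    then show ?thesis using ge[of "{}"] gT[of "{}"] empty by simp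
  qed
  ultimately have "card T = m" by simp
  moreover have "0 \<le> \<phi> K + (\<Sum>i\<in>T. xi {v i} K)" if "K \<subseteq> V" for K
    using ge[OF that] gT[of K] \<open>card T = m\<close> by simp
  ultimately show thesis using that[of T v] T(1) v JJ(1) by (meson subsetD)
qed


section \<open>Subspaces of direct sums\<close>

lemma sum_fun_apply: "(sum f A) x = (\<Sum>a\<in>A. f a x)" for f :: "'a \<Rightarrow> 'b \<Rightarrow> 'c::comm_monoid_add"
  by (induction A rule: infinite_finite_induct) auto

lemma xi_antimono: "K \<subseteq> K' \<Longrightarrow> xi J K' \<le> xi J K"
  by (auto simp: xi_def)

lemma UpMin_le: "finite V \<Longrightarrow> I \<subseteq> K \<Longrightarrow> K \<subseteq> V \<Longrightarrow> UpMin V \<psi> I \<le> \<psi> K"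
  unfolding UpMin_def by (intro Min_le) auto

lemma UpMin_attained:
  assumes "finite V" "I \<subseteq> V"
  obtains K where "I \<subseteq> K" "K \<subseteq> V" "UpMin V \<psi> I = \<psi> K"
proof -
  have "UpMin V \<psi> I \<in> \<psi> ` {K. I \<subseteq> K \<and> K \<subseteq> V}"
    unfolding UpMin_def using assms by (intro Min_in) auto
  then show thesis using that by auto
qed

text \<open>The spaces \<open>U v\<close> enter only through vanishing outside \<open>V\<close>,
  which makes \<open>proj V\<close> the identity on \<open>W\<close>.\<close>

locale direct_sum_subspace = vector_space scale
  for scale :: "'k::field \<Rightarrow> 'u \<Rightarrow> 'u::ab_group_add" +
  fixes V :: "'v set" and W :: "('v \<Rightarrow> 'u) set"
  assumes finV: "finite V"
    and subspace_W: "module.subspace (pscale scale) W"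
    and finite_dim_W: "finite_dim (pscale scale) W"
    and W_outside: "\<And>w v. w \<in> W \<Longrightarrow> v \<notin> V \<Longrightarrow> w v = 0"
begin

sublocale pw: vector_space "pscale scale"
  by (rule vector_space_pscale) (rule vector_space_axioms)

abbreviation r :: "'v set \<Rightarrow> int" where "r \<equiv> submod_fun scale W"

lemma linear_proj: "Vector_Spaces.linear (pscale scale) (pscale scale) (proj I)"
  unfolding Vector_Spaces.linear_iff
  using pw.vector_space_axioms by (auto simp: proj_def pscale_def fun_eq_iff)

lemma dim_proj_image:
  assumes "pw.subspace X" "X \<subseteq> W"
  shows "pw.dim (proj I ` X) + pw.dim {x \<in> X. \<forall>v\<in>I. x v = 0} = pw.dim X"
proof -
  interpret pp: vector_space_pair "pscale scale" "pscale scale"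
    by (simp add: vector_space_pair_def pw.vector_space_axioms)
  have "{x \<in> X. proj I x = 0} = {x \<in> X. \<forall>v\<in>I. x v = 0}"
    by (auto simp: proj_def fun_eq_iff)
  then show ?thesis
    using pp.dim_image_plus_dim_kernel[OF linear_proj assms(1), of I]
      pw.finite_dim_subset[OF assms(2) finite_dim_W] by simp
qed

definition ker_proj :: "'v set \<Rightarrow> ('v \<Rightarrow> 'u) set" where
  "ker_proj I = {w \<in> W. \<forall>v\<in>I. w v = 0}"

lemma subspace_ker_proj: "pw.subspace (ker_proj I)"
  using subspace_W unfolding pw.subspace_def ker_proj_def by (auto simp: pscale_def)

lemma ker_proj_subset: "ker_proj I \<subseteq> W"
  by (auto simp: ker_proj_def)

lemma finite_dim_subset_W: "X \<subseteq> W \<Longrightarrow> finite_dim (pscale scale) X"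
  using finite_dim_W pw.finite_dim_subset by blast

lemma r_plus_dim_ker: "r I + int (pw.dim (ker_proj I)) = int (pw.dim W)"
  using dim_proj_image[OF subspace_W order_refl, of I] by (simp add: submod_fun_def ker_proj_def)

lemma dim_le: "X \<subseteq> Y \<Longrightarrow> Y \<subseteq> W \<Longrightarrow> pw.dim X \<le> pw.dim Y"
  using pw.dim_mono_finite_dim finite_dim_subset_W by blast

lemma r_mono: "I \<subseteq> K \<Longrightarrow> r I \<le> r K"
  using r_plus_dim_ker[of I] r_plus_dim_ker[of K] dim_le[of "ker_proj K" "ker_proj I"]
  by (force simp: ker_proj_def)

lemma r_nonneg: "0 \<le> r I"
  by (simp add: submod_fun_def)

lemma dim_proj_V:
  assumes "pw.subspace X" "X \<subseteq> W"
  shows "pw.dim (proj V ` X) = pw.dim X"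
proof -
  have "proj V x = x" if "x \<in> X" for x
    using W_outside assms that by (fastforce simp: proj_def fun_eq_iff)
  then have "proj V ` X = X" by simp
  then show ?thesis by simp
qed

text \<open>Both increments of \<open>r\<close> are dimensions of images under \<open>proj K'\<close>, of the kernels
  \<open>ker_proj K \<subseteq> ker_proj (K \<inter> K')\<close>.\<close>
lemma r_submodular: "r (K \<union> K') + r (K \<inter> K') \<le> r K + r K'"
proof -
  have "{x \<in> ker_proj K. \<forall>v\<in>K'. x v = 0} = ker_proj (K \<union> K')"
    "{x \<in> ker_proj (K \<inter> K'). \<forall>v\<in>K'. x v = 0} = ker_proj K'"
    by (auto simp: ker_proj_def)
  then have "pw.dim (proj K' ` ker_proj K) + pw.dim (ker_proj (K \<union> K')) = pw.dim (ker_proj K)"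
    "pw.dim (proj K' ` ker_proj (K \<inter> K')) + pw.dim (ker_proj K') = pw.dim (ker_proj (K \<inter> K'))"
    using dim_proj_image[OF subspace_ker_proj ker_proj_subset, of K' K]
      dim_proj_image[OF subspace_ker_proj ker_proj_subset, of K' "K \<inter> K'"] by simp_all
  moreover have "pw.dim (proj K' ` ker_proj K) \<le> pw.dim (proj K' ` ker_proj (K \<inter> K'))"
  proof (rule pw.dim_mono_finite_dim)
    show "proj K' ` ker_proj K \<subseteq> proj K' ` ker_proj (K \<inter> K')" by (auto simp: ker_proj_def)
    obtain B where B: "finite B" "ker_proj (K \<inter> K') \<subseteq> pw.span B"
      using finite_dim_subset_W[OF ker_proj_subset] by (auto simp: finite_dim_def)
    interpret pp: vector_space_pair "pscale scale" "pscale scale"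
      by (simp add: vector_space_pair_def pw.vector_space_axioms)
    show "finite_dim (pscale scale) (proj K' ` ker_proj (K \<inter> K'))"
      unfolding finite_dim_def
      using B pp.linear_span_image[OF linear_proj, of K' B] by (intro exI[of _ "proj K' ` B"]) auto
  qed
  ultimately show ?thesis
    using r_plus_dim_ker[of K] r_plus_dim_ker[of K'] r_plus_dim_ker[of "K \<union> K'"] r_plus_dim_ker[of "K \<inter> K'"]
    by linarith
qed

text \<open>Here the claim is reduced to \<open>bound\<close>, which says how far the forms must cut
  down each \<open>ker_proj I\<close>. The hypothesis \<open>vanish\<close> says that
  \<open>L i\<close> depends only on the coordinates in \<open>J i\<close>.\<close>

lemma has_submod_fun_common_kernel:
  assumes A: "finite A" and lin: "\<And>i. i \<in> A \<Longrightarrow> Vector_Spaces.linear (pscale scale) (*) (L i)"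
    and vanish: "\<And>i w. i \<in> A \<Longrightarrow> w \<in> ker_proj (J i) \<Longrightarrow> L i w = 0"
    and nonneg: "nonneg_on V (r + (\<Sum>i\<in>A. xi (J i)))"
    and bound: "\<And>I. I \<subseteq> V \<Longrightarrow> int (pw.dim {x \<in> ker_proj I. \<forall>i\<in>A. L i x = 0})
      + UpMin V (r + (\<Sum>i\<in>A. xi (J i))) I + int (card A) \<le> int (pw.dim W)"
  shows "has_submod_fun scale V {w \<in> W. \<forall>i\<in>A. L i w = 0} (UpMin V (r + (\<Sum>i\<in>A. xi (J i))))"
  unfolding has_submod_fun_def
proof (intro allI impI)
  fix I assume I: "I \<subseteq> V"
  let ?\<psi> = "r + (\<Sum>i\<in>A. xi (J i))"
  let ?X = "{w \<in> W. \<forall>i\<in>A. L i w = 0}"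
  have \<psi>: "?\<psi> K = r K + (\<Sum>i\<in>A. xi (J i) K)" for K by (simp add: sum_fun_apply)
  have X: "pw.subspace ?X" "?X \<subseteq> W"
    using pw.subspace_common_kernel[of A L W] lin subspace_W by auto
  have img: "submod_fun scale ?X K + int (pw.dim {x \<in> ker_proj K. \<forall>i\<in>A. L i x = 0}) = int (pw.dim ?X)" for K
  proof -
    have "{x \<in> ?X. \<forall>v\<in>K. x v = 0} = {x \<in> ker_proj K. \<forall>i\<in>A. L i x = 0}" by (auto simp: ker_proj_def)
    then show ?thesis using dim_proj_image[OF X, of K] by (simp add: submod_fun_def)
  qed
  show "submod_fun scale ?X I = UpMin V ?\<psi> I"
  proof (rule antisym)
    have "pw.dim W \<le> pw.dim ?X + card A"
      by (rule pw.dim_le_dim_common_kernel) (use A lin subspace_W finite_dim_W in auto)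
    then show "UpMin V ?\<psi> I \<le> submod_fun scale ?X I"
      using img[of I] bound[OF I] by linarith
  next
    obtain K where K: "I \<subseteq> K" "K \<subseteq> V" "UpMin V ?\<psi> I = ?\<psi> K"
      using UpMin_attained[OF finV I] by blast
    \<comment> \<open>This is where nonnegativity enters: at the empty set, \<open>bound\<close>
      makes all \<open>card A\<close> forms independent on \<open>W\<close>.\<close>
    have "0 \<le> UpMin V ?\<psi> {}"
      using UpMin_attained[OF finV, of "{}" ?\<psi>] nonneg unfolding nonneg_on_def by force
    moreover have "ker_proj {} = W" by (simp add: ker_proj_def)
    ultimately have dX: "pw.dim ?X + card A \<le> pw.dim W" using bound[of "{}"] by simp
    \<comment> \<open>A form with \<open>J i \<subseteq> K\<close> vanishes on
      \<open>ker_proj K\<close>, so only the forms indexed by \<open>?B\<close> can cut it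
      down.\<close>
    let ?B = "{i \<in> A. \<not> J i \<subseteq> K}"
    have "pw.dim (ker_proj K) \<le> pw.dim {x \<in> ker_proj K. \<forall>i\<in>?B. L i x = 0} + card ?B"
      by (rule pw.dim_le_dim_common_kernel)
        (use A lin subspace_ker_proj finite_dim_subset_W ker_proj_subset in auto)
    moreover have "{x \<in> ker_proj K. \<forall>i\<in>?B. L i x = 0} = {x \<in> ker_proj K. \<forall>i\<in>A. L i x = 0}"
    proof -
      have "L i x = 0" if "x \<in> ker_proj K" "i \<in> A" "J i \<subseteq> K" for i x
        using that by (intro vanish) (auto simp: ker_proj_def)
      then show ?thesis by blast
    qed
    moreover have "(\<Sum>i\<in>A. xi (J i) K) = int (card ?B) - int (card A)"
    proof -
      have "(\<Sum>i\<in>A. xi (J i) K) = (\<Sum>i\<in>A. (if \<not> J i \<subseteq> K then 1 else 0) - 1)"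
        by (intro sum.cong) (auto simp: xi_def)
      also have "\<dots> = (\<Sum>i\<in>A. if \<not> J i \<subseteq> K then 1 else 0) - int (card A)"
        by (simp add: sum_subtractf)
      also have "(\<Sum>i\<in>A. if \<not> J i \<subseteq> K then 1 else 0) = int (card ?B)"
        by (subst sum.inter_filter[OF A, symmetric]) simp
      finally show ?thesis .
    qed
    ultimately have "submod_fun scale ?X K \<le> ?\<psi> K"
      using img[of K] dX r_plus_dim_ker[of K] \<psi>[of K] by simp
    moreover have "submod_fun scale ?X I \<le> submod_fun scale ?X K"
    proof -
      have "pw.dim {x \<in> ker_proj K. \<forall>i\<in>A. L i x = 0} \<le> pw.dim {x \<in> ker_proj I. \<forall>i\<in>A. L i x = 0}"
        by (rule dim_le) (use K in \<open>auto simp: ker_proj_def\<close>)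
      then show ?thesis using img[of K] img[of I] by linarith
    qed
    ultimately show "submod_fun scale ?X I \<le> UpMin V ?\<psi> I" using K(3) by simp
  qed
qed

text \<open>For a single \<open>I\<close>, the polynomial is an \<open>m\<close>-rowed minor of the
  matrix of values of the forms on vectors of \<open>ker_proj I\<close>, in the coefficients
  \<open>c\<close>. The map \<open>e i\<close> only labels the variables of the \<open>i\<close>-th
  factor.\<close>

lemma multihomogeneous_condition:
  fixes A :: "'i set" and e :: "'i \<Rightarrow> 'v \<Rightarrow> 'w" and J J' :: "'i \<Rightarrow> 'v set"
  assumes A: "finite A" and JV: "\<And>i. i \<in> A \<Longrightarrow> J i \<subseteq> V" and J': "\<And>i. i \<in> A \<Longrightarrow> J' i \<subseteq> J i"
    and lin: "\<And>i v. i \<in> A \<Longrightarrow> v \<in> J i \<Longrightarrow> Vector_Spaces.linear (pscale scale) (*) (a i v)"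
    and a0: "\<And>i v w. i \<in> A \<Longrightarrow> v \<in> J i - J' i \<Longrightarrow> w \<in> W \<Longrightarrow> a i v w = 0"
    and e: "\<And>i. i \<in> A \<Longrightarrow> inj_on (e i) (J' i)"
    and hyp: "\<And>T v. T \<subseteq> A \<Longrightarrow> (\<And>i. i \<in> T \<Longrightarrow> v i \<in> J i) \<Longrightarrow>
      (\<And>K. K \<subseteq> V \<Longrightarrow> 0 \<le> r K + (\<Sum>i\<in>T. xi {v i} K)) \<Longrightarrow>
      has_submod_fun scale V {w \<in> W. \<forall>i\<in>T. a i (v i) w = 0} (UpMin V (\<lambda>K. r K + (\<Sum>i\<in>T. xi {v i} K)))"
    and I: "I \<subseteq> V"
  shows "\<exists>f. multihomogeneous A (\<lambda>i. e i ` J' i) f \<and> f \<noteq> 0 \<and>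
    (\<forall>c. poly_eval f c \<noteq> 0 \<longrightarrow>
      (\<forall>L. (\<forall>i\<in>A. Vector_Spaces.linear (pscale scale) (*) (L i) \<and>
                   (\<forall>w\<in>W. L i w = (\<Sum>v\<in>J' i. c (i, e i v) * a i v w))) \<longrightarrow>
        int (pw.dim {x \<in> ker_proj I. \<forall>i\<in>A. L i x = 0})
          + UpMin V (r + (\<Sum>i\<in>A. xi (J i))) I + int (card A) \<le> int (pw.dim W)))"
proof -
  let ?\<psi> = "r + (\<Sum>i\<in>A. xi (J i))"
  have \<psi>: "?\<psi> K = r K + (\<Sum>i\<in>A. xi (J i) K)" for K by (simp add: sum_fun_apply)
  \<comment> \<open>This is the rank required on \<open>ker_proj I\<close>. It is nonnegative, as
    \<open>r\<close> is monotone and each \<open>xi\<close> is at least -1, so \<open>nat\<close>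
    loses nothing.\<close>
  define m where "m = nat (UpMin V ?\<psi> I + int (card A) - r I)"
  have m: "int m = UpMin V ?\<psi> I + int (card A) - r I"
  proof -
    obtain K where K: "I \<subseteq> K" "K \<subseteq> V" "UpMin V ?\<psi> I = ?\<psi> K"
      using UpMin_attained[OF finV I] by blast
    have "(\<Sum>i\<in>A. - 1) \<le> (\<Sum>i\<in>A. xi (J i) K)" by (intro sum_mono) (simp add: xi_def)
    then show ?thesis using r_mono[OF K(1)] K(3) \<psi>[of K] by (simp add: m_def)
  qed
  \<comment> \<open>Rado's theorem is applied to \<open>r\<close> contracted by \<open>I\<close>.
    Its bound at \<open>K\<close> comes from \<open>UpMin\<close> at \<open>K \<union> I\<close>,
    since enlarging \<open>K\<close> can only lower the \<open>xi\<close>.\<close>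
  obtain T v where T: "T \<subseteq> A" "card T = m" and v: "\<And>i. i \<in> T \<Longrightarrow> v i \<in> J i"
    and ind: "\<And>K. K \<subseteq> V \<Longrightarrow> 0 \<le> (r (K \<union> I) - r I) + (\<Sum>i\<in>T. xi {v i} K)"
  proof (rule defect_Rado_polymatroid[where \<phi> = "\<lambda>K. r (K \<union> I) - r I" and m = m, OF finV A JV])
    fix K K'
    have "(K \<union> I) \<union> (K' \<union> I) = (K \<union> K') \<union> I" "(K \<union> I) \<inter> (K' \<union> I) = (K \<inter> K') \<union> I" by auto
    then show "r (K \<union> K' \<union> I) - r I + (r (K \<inter> K' \<union> I) - r I) \<le> r (K \<union> I) - r I + (r (K' \<union> I) - r I)"
      using r_submodular[of "K \<union> I" "K' \<union> I"] by simp
  next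
    fix K assume "K \<subseteq> V"
    then have "UpMin V ?\<psi> I \<le> ?\<psi> (K \<union> I)" using I finV by (intro UpMin_le) auto
    moreover have "(\<Sum>i\<in>A. xi (J i) (K \<union> I)) \<le> (\<Sum>i\<in>A. xi (J i) K)"
      by (intro sum_mono xi_antimono) auto
    ultimately show "int m \<le> r (K \<union> I) - r I + int (card A) + (\<Sum>i\<in>A. xi (J i) K)"
      using m \<psi>[of "K \<union> I"] by simp
  qed (use r_mono in auto)
  have fT: "finite T" using T(1) A finite_subset by blast
  define \<chi> where "\<chi> K = r K + (\<Sum>i\<in>T. xi {v i} K)" for K
  let ?Y = "{w \<in> W. \<forall>i\<in>T. a i (v i) w = 0}"
  have linT: "Vector_Spaces.linear (pscale scale) (*) (a i (v i))" if "i \<in> T" for i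
    using lin v T(1) that by blast
  have Y: "pw.subspace ?Y" "?Y \<subseteq> W"
    using pw.subspace_common_kernel[of T "\<lambda>i. a i (v i)" W] linT subspace_W by auto
  have subY: "has_submod_fun scale V ?Y (UpMin V \<chi>)"
    unfolding \<chi>_def
  proof (rule hyp[OF T(1) v])
    \<comment> \<open>Submodularity gives \<open>r (K \<union> I) - r I \<le> r K\<close>, so
      independence over \<open>I\<close> implies the plain inequality.\<close>
    fix K assume "K \<subseteq> V"
    then show "0 \<le> r K + (\<Sum>i\<in>T. xi {v i} K)"
      using ind[of K] r_submodular[of K I] r_nonneg[of "K \<inter> I"] by linarith
  qed
  \<comment> \<open>For the cut space \<open>?Y\<close> the function is at least \<open>r I\<close>
    at \<open>I\<close> and at most \<open>dim W - m\<close> at \<open>V\<close>. The difference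
    bounds the kernel of \<open>proj I\<close> on \<open>?Y\<close>.\<close>
  have le: "pw.dim {x \<in> ker_proj I. \<forall>i\<in>T. a i (v i) x = 0} + card T \<le> pw.dim (ker_proj I)"
  proof -
    have "r I \<le> UpMin V \<chi> I"
    proof -
      obtain K where K: "I \<subseteq> K" "K \<subseteq> V" "UpMin V \<chi> I = \<chi> K"
        using UpMin_attained[OF finV I] by blast
      have "K \<union> I = K" using K(1) by auto
      then show ?thesis using ind[OF K(2)] K(3) by (simp add: \<chi>_def)
    qed
    moreover have "UpMin V \<chi> V \<le> int (pw.dim W) - int m"
    proof -
      have "(\<Sum>i\<in>T. xi {v i} V) = (\<Sum>i\<in>T. - 1)"
        using v JV T(1) by (intro sum.cong) (auto simp: xi_def)
      moreover have "r V = int (pw.dim W)" using dim_proj_V[OF subspace_W] by (simp add: submod_fun_def)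
      ultimately have "\<chi> V = int (pw.dim W) - int m" using T(2) by (simp add: \<chi>_def)
      then show ?thesis using UpMin_le[OF finV order_refl order_refl, of \<chi>] by simp
    qed
    moreover have "submod_fun scale ?Y I = UpMin V \<chi> I" "submod_fun scale ?Y V = UpMin V \<chi> V"
      using subY I by (auto simp: has_submod_fun_def)
    moreover have "submod_fun scale ?Y V = int (pw.dim ?Y)"
      using dim_proj_V[OF Y] by (simp add: submod_fun_def)
    moreover have "{x \<in> ?Y. \<forall>v\<in>I. x v = 0} = {x \<in> ker_proj I. \<forall>i\<in>T. a i (v i) x = 0}"
      by (auto simp: ker_proj_def)
    then have "submod_fun scale ?Y I + int (pw.dim {x \<in> ker_proj I. \<forall>i\<in>T. a i (v i) x = 0}) = int (pw.dim ?Y)"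
      using dim_proj_image[OF Y, of I] by (simp add: submod_fun_def)
    ultimately show ?thesis using r_plus_dim_ker[of I] T(2) by linarith
  qed
  obtain y where y: "\<And>j. j \<in> T \<Longrightarrow> y j \<in> ker_proj I"
    and dual: "\<And>i j. i \<in> T \<Longrightarrow> j \<in> T \<Longrightarrow> a i (v i) (y j) = (if i = j then 1 else 0)"
  proof (rule pw.dual_system_if_dim_common_kernel[OF fT _ subspace_ker_proj
        finite_dim_subset_W[OF ker_proj_subset] le])
    fix y assume "\<And>j. j \<in> T \<Longrightarrow> y j \<in> ker_proj I"
      and "\<And>i j. i \<in> T \<Longrightarrow> j \<in> T \<Longrightarrow> a i (v i) (y j) = (if i = j then 1 else 0)"
    then show thesis by (rule that)
  qed (rule linT)
  have yW: "y j \<in> W" if "j \<in> T" for j using y[OF that] ker_proj_subset by auto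
  \<comment> \<open>The form of \<open>v i\<close> takes the value 1 on \<open>y i\<close>, so it is
    not one of the forms that vanish on \<open>W\<close> and its coefficient is a genuine
    variable.\<close>
  have vJ': "v i \<in> J' i" if "i \<in> T" for i
    using a0[of i "v i" "y i"] dual[OF that that] yW[OF that] v[OF that] T(1) that by auto
  obtain t where t: "bij_betw t {..<m} T"
    using ex_bij_betw_nat_finite[OF fT] T(2) by (auto simp: atLeast0LessThan)
  have tT: "t q \<in> T" if "q < m" for q using t that by (auto simp: bij_betw_def)
  have tA: "t q \<in> A" if "q < m" for q using tT[OF that] T(1) by auto
  have t_eq: "t p = t q \<longleftrightarrow> p = q" if "p < m" "q < m" for p q
    using t that by (auto simp: bij_betw_def inj_on_def)
  have finJ': "finite (J' i)" if "i \<in> A" for i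
    using J'[OF that] JV[OF that] finV by (meson finite_subset)
  \<comment> \<open>Entry \<open>(p, q)\<close> is the form of index \<open>t q\<close> with
    indeterminate coefficients, evaluated at \<open>y (t p)\<close>.\<close>
  define F where "F p q = (\<Sum>u\<in>J' (t q). Poly_Mapping.single (Poly_Mapping.single (t q, e (t q) u) (1::nat))
    (a (t q) u (y (t p))))" for p q
  define f where "f = det (mat m m (\<lambda>(p, q). F p q))"
  have eval_F: "poly_eval (F p q) c = (\<Sum>u\<in>J' (t q). c (t q, e (t q) u) * a (t q) u (y (t p)))" for p q c
    by (simp add: F_def poly_eval_sum poly_eval_single monom_eval_def mult.commute)
  have eval_f: "poly_eval f c = det (mat m m (\<lambda>(p, q). poly_eval (F p q) c))" for c
  proof -
    interpret h: comm_ring_hom "\<lambda>f. poly_eval f c" by (rule comm_ring_hom_poly_eval)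
    have "map_mat (\<lambda>f. poly_eval f c) (mat m m (\<lambda>(p, q). F p q)) = mat m m (\<lambda>(p, q). poly_eval (F p q) c)"
      by (rule eq_matI) auto
    then show ?thesis unfolding f_def by (metis h.hom_det)
  qed
  have "multihomogeneous_deg A (\<lambda>i. e i ` J' i) (\<lambda>i. \<Sum>q<m. if i = t q then 1 else 0) f"
    unfolding f_def
  proof (rule multihomogeneous_deg_det[where deg = "\<lambda>q i. if i = t q then 1 else 0"])
    fix p q assume "q < m"
    then show "multihomogeneous_deg A (\<lambda>i. e i ` J' i) (\<lambda>i. if i = t q then 1 else 0) (F p q)"
      unfolding F_def using tA finJ' by (intro multihomogeneous_deg_sum multihomogeneous_deg_linear_monom) auto
  qed
  then have "multihomogeneous A (\<lambda>i. e i ` J' i) f" by (auto simp: multihomogeneous_iff_deg)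
  moreover have "f \<noteq> 0"
  proof -
    \<comment> \<open>With coefficient 1 at \<open>v i\<close> and 0 elsewhere in
      \<open>J' i\<close>, for \<open>i \<in> T\<close>, duality turns the matrix into the
      identity.\<close>
    define c where "c = (\<lambda>(i, x). if x = e i (v i) then 1 else 0 :: 'k)"
    have "poly_eval (F p q) c = (if p = q then 1 else 0)" if pq: "p < m" "q < m" for p q
    proof -
      have "poly_eval (F p q) c = (\<Sum>u\<in>J' (t q). if u = v (t q) then a (t q) u (y (t p)) else 0)"
        unfolding eval_F c_def
      proof (intro sum.cong refl)
        fix u assume "u \<in> J' (t q)"
        then have "e (t q) u = e (t q) (v (t q)) \<longleftrightarrow> u = v (t q)"
          using e[OF tA[OF pq(2)]] vJ'[OF tT[OF pq(2)]] by (auto simp: inj_on_def)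
        then show "(case (t q, e (t q) u) of (i, x) \<Rightarrow> if x = e i (v i) then 1 else 0) * a (t q) u (y (t p)) =
            (if u = v (t q) then a (t q) u (y (t p)) else 0)" by simp
      qed
      also have "\<dots> = a (t q) (v (t q)) (y (t p))"
        using finJ'[OF tA[OF pq(2)]] vJ'[OF tT[OF pq(2)]] by simp
      also have "\<dots> = (if p = q then 1 else 0)"
        using dual[OF tT[OF pq(2)] tT[OF pq(1)]] t_eq[OF pq] by auto
      finally show ?thesis .
    qed
    then have "mat m m (\<lambda>(p, q). poly_eval (F p q) c) = 1\<^sub>m m" by (intro eq_matI) auto
    then have "poly_eval f c = 1" by (simp add: eval_f)
    then show ?thesis by auto
  qed
  moreover have "int (pw.dim {x \<in> ker_proj I. \<forall>i\<in>A. L i x = 0})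
          + UpMin V ?\<psi> I + int (card A) \<le> int (pw.dim W)"
    if c: "poly_eval f c \<noteq> 0" and L: "\<forall>i\<in>A. Vector_Spaces.linear (pscale scale) (*) (L i) \<and>
                   (\<forall>w\<in>W. L i w = (\<Sum>v\<in>J' i. c (i, e i v) * a i v w))" for c L
  proof -
    have "mat m m (\<lambda>(p, q). poly_eval (F p q) c) = mat m m (\<lambda>(p, q). L (t q) (y (t p)))"
      using L tA yW tT by (intro eq_matI) (auto simp: eval_F)
    then have det: "det (mat m m (\<lambda>(p, q). L (t q) (y (t p)))) \<noteq> 0" using c by (simp add: eval_f)
    \<comment> \<open>The nonzero minor makes the \<open>m\<close> forms \<open>L (t q)\<close>
      independent on \<open>ker_proj I\<close>; the remaining forms can only shrink the common
      kernel.\<close>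
    have "pw.dim {x \<in> ker_proj I. \<forall>q<m. L (t q) x = 0} + m \<le> pw.dim (ker_proj I)"
      by (rule pw.dim_common_kernel_le_dim_det[OF _ _ _ _ det])
        (use L tA tT y subspace_ker_proj finite_dim_subset_W[OF ker_proj_subset] in auto)
    moreover have "pw.dim {x \<in> ker_proj I. \<forall>i\<in>A. L i x = 0} \<le> pw.dim {x \<in> ker_proj I. \<forall>q<m. L (t q) x = 0}"
      by (rule dim_le) (use tA ker_proj_subset in auto)
    ultimately show ?thesis using m r_plus_dim_ker[of I] by linarith
  qed
  ultimately show ?thesis by blast
qed

end

section \<open>Quotient bases of direct sums\<close>

definition coord :: "'v \<Rightarrow> 'u \<Rightarrow> 'v \<Rightarrow> 'u::zero" where
  "coord v b = (\<lambda>x. if x = v then b else 0)"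

context vector_space
begin

lemma linear_coord: "Vector_Spaces.linear scale (pscale scale) (coord v)"
  unfolding Vector_Spaces.linear_iff
  using vector_space_axioms vector_space_pscale[OF vector_space_axioms]
  by (auto simp: coord_def pscale_def fun_eq_iff)

lemma finite_dim_direct_sum:
  assumes "finite V" and "\<And>v. v \<in> V \<Longrightarrow> finite_dim scale (U v)"
  shows "finite_dim (pscale scale) (direct_sum V U)"
proof -
  interpret pp: vector_space_pair scale "pscale scale"
    by (simp add: vector_space_pair_def vector_space_axioms vector_space_pscale)
  have "\<forall>v\<in>V. \<exists>B. finite B \<and> U v \<subseteq> span B" using assms(2) by (auto simp: finite_dim_def)
  then obtain B where B: "\<And>v. v \<in> V \<Longrightarrow> finite (B v)" "\<And>v. v \<in> V \<Longrightarrow> U v \<subseteq> span (B v)" by metis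
  let ?C = "\<Union>v\<in>V. coord v ` B v"
  have "x \<in> pp.vs2.span ?C" if x: "x \<in> direct_sum V U" for x
  proof -
    have eq: "(\<Sum>v\<in>V. coord v (x v)) = x"
    proof
      fix v
      have "(\<Sum>v'\<in>V. coord v' (x v') v) = (\<Sum>v'\<in>V. if v' = v then x v else 0)"
        by (intro sum.cong) (auto simp: coord_def)
      then show "(\<Sum>v'\<in>V. coord v' (x v')) v = x v"
        using x assms(1) by (auto simp: sum_fun_apply direct_sum_def)
    qed
    have "coord v (x v) \<in> pp.vs2.span ?C" if "v \<in> V" for v
    proof -
      have "coord v (x v) \<in> coord v ` span (B v)" using x B(2)[OF that] that by (auto simp: direct_sum_def)
      also have "\<dots> = pp.vs2.span (coord v ` B v)" by (rule pp.linear_span_image[OF linear_coord, symmetric])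
      also have "\<dots> \<subseteq> pp.vs2.span ?C" using that by (intro pp.vs2.span_mono) auto
      finally show ?thesis .
    qed
    then have "(\<Sum>v\<in>V. coord v (x v)) \<in> pp.vs2.span ?C" by (intro pp.vs2.span_sum)
    then show ?thesis by (simp only: eq)
  qed
  then show ?thesis unfolding finite_dim_def using assms(1) B(1) by (intro exI[of _ ?C]) auto
qed

lemma subspace_direct_sum:
  assumes "\<And>v. v \<in> J \<Longrightarrow> subspace (U v)"
  shows "module.subspace (pscale scale) (direct_sum J U)"
proof -
  interpret pw: vector_space "pscale scale" by (rule vector_space_pscale) (rule vector_space_axioms)
  show ?thesis using assms unfolding pw.subspace_def subspace_def direct_sum_def
    by (auto simp: pscale_def)
qed

text \<open>Componentwise reduction modulo \<open>N v\<close>; outside \<open>J'\<close> nothing is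
  subtracted because \<open>N v = U v\<close>. It also determines a form that vanishes on
  \<open>direct_sum J N\<close> by its values on the vectors \<open>coord v (u v)\<close>.\<close>

lemma direct_sum_reduce:
  assumes J: "finite J" and J': "J' = {v \<in> J. N v \<noteq> U v}"
    and dec: "\<And>v x. v \<in> J \<Longrightarrow> x \<in> U v \<Longrightarrow> x - scale (g v x) (u v) \<in> N v"
    and x: "x \<in> direct_sum J U"
  shows "x - (\<Sum>v\<in>J'. pscale scale (g v (x v)) (coord v (u v))) \<in> direct_sum J N"
proof -
  have *: "(\<Sum>v\<in>J'. pscale scale (g v (x v)) (coord v (u v))) v =
      (if v \<in> J' then scale (g v (x v)) (u v) else 0)" for v
  proof -
    have "(\<Sum>v'\<in>J'. pscale scale (g v' (x v')) (coord v' (u v')) v) =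
        (\<Sum>v'\<in>J'. if v' = v then scale (g v (x v)) (u v) else 0)"
      by (intro sum.cong) (auto simp: coord_def pscale_def)
    then show ?thesis using J J' by (simp add: sum_fun_apply)
  qed
  have "x v - (if v \<in> J' then scale (g v (x v)) (u v) else 0) \<in> N v" if "v \<in> J" for v
  proof (cases "v \<in> J'")
    case True
    then show ?thesis using dec[OF that, of "x v"] x that by (simp add: direct_sum_def)
  next
    case False
    then have "N v = U v" using that J' by simp
    then show ?thesis using False x that by (simp add: direct_sum_def)
  qed
  moreover have "v \<notin> J'" if "v \<notin> J" for v using that J' by simp
  ultimately show ?thesis using x by (simp add: direct_sum_def *)
qed

text \<open>Each \<open>v \<in> J'\<close> contributes a line \<open>U v / N v\<close> spanned by
  the class of \<open>u v\<close>, and each other \<open>v\<close> contributes nothing.\<close>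

lemma quotient_basis_direct_sum:
  assumes J: "finite J" and J': "J' = {v \<in> J. N v \<noteq> U v}"
    and U: "\<And>v. v \<in> J \<Longrightarrow> subspace (U v)" and N: "\<And>v. v \<in> J \<Longrightarrow> subspace (N v)"
    and NU: "\<And>v. v \<in> J \<Longrightarrow> N v \<subseteq> U v" and uU: "\<And>v. v \<in> J \<Longrightarrow> u v \<in> U v"
    and lin: "\<And>v. v \<in> J \<Longrightarrow> Vector_Spaces.linear scale (*) (g v)"
    and gN: "\<And>v x. v \<in> J \<Longrightarrow> x \<in> N v \<Longrightarrow> g v x = 0"
    and gu: "\<And>v. v \<in> J' \<Longrightarrow> g v (u v) = 1"
    and dec: "\<And>v x. v \<in> J \<Longrightarrow> x \<in> U v \<Longrightarrow> x - scale (g v x) (u v) \<in> N v"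
  shows "quotient_basis (pscale scale) (direct_sum J U) (direct_sum J N) ((\<lambda>v. coord v (u v)) ` J')"
proof -
  interpret pw: vector_space "pscale scale" by (rule vector_space_pscale) (rule vector_space_axioms)
  let ?e = "\<lambda>v. coord v (u v)"
  have finJ': "finite J'" using J J' by simp
  have g0: "g v 0 = 0" if "v \<in> J" for v
    using lin[OF that] by (metis Vector_Spaces.linear_iff mult_zero_left scale_zero_left)
  \<comment> \<open>\<open>s\<close> reads off the coordinates with the forms \<open>g v\<close>: it
    fixes the span of the basis vectors and kills \<open>direct_sum J N\<close>, so these meet only
    in 0.\<close>
  define s where "s x = (\<Sum>v\<in>J'. pscale scale (g v (x v)) (?e v))" for x
  have sub: "pw.subspace {x. x = s x}"
  proof -
    have gl: "g v (y + z) = g v y + g v z" "g v (scale c y) = c * g v y" if "v \<in> J'" for v y z c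
      using lin[of v] that J' by (auto simp: Vector_Spaces.linear_iff)
    have "s 0 = 0" unfolding s_def by (intro sum.neutral) (use g0 J' in auto)
    moreover have "s (x + y) = s x + s y" for x y
      unfolding s_def sum.distrib[symmetric]
      by (intro sum.cong refl) (simp add: gl pw.scale_left_distrib)
    moreover have "s (pscale scale c x) = pscale scale c (s x)" for c x
      unfolding s_def pw.scale_sum_right
      by (intro sum.cong refl) (simp add: gl pscale_def)
    ultimately show ?thesis unfolding pw.subspace_def by simp
  qed
  have ge: "g v (?e v' v) = (if v = v' then 1 else 0)" if "v \<in> J'" "v' \<in> J'" for v v'
    using gu g0 that J' by (auto simp: coord_def)
  have span_E: "x = s x" if "x \<in> pw.span (?e ` J')" for x
  proof -
    have "pw.span (?e ` J') \<subseteq> {x. x = s x}"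
    proof (rule pw.span_minimal[OF _ sub], safe)
      fix v assume v: "v \<in> J'"
      have "s (?e v) = (\<Sum>v'\<in>J'. if v' = v then ?e v else 0)"
        unfolding s_def by (intro sum.cong refl) (use ge v in auto)
      then show "?e v = s (?e v)" using v finJ' by simp
    qed
    then show ?thesis using that by blast
  qed
  have eU: "?e v \<in> direct_sum J U" if "v \<in> J'" for v
    using that uU J' U subspace_0 by (auto simp: direct_sum_def coord_def)
  have "\<not> pw.dependent (?e ` J')"
  proof
    assume "pw.dependent (?e ` J')"
    then obtain v where v: "v \<in> J'" "?e v \<in> pw.span (?e ` J' - {?e v})" by (auto simp: pw.dependent_def)
    \<comment> \<open>The kernel of the coordinate \<open>g v\<close> contains all other basis
      vectors but not this one.\<close>
    have "pw.subspace {x. g v (x v) = 0}"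
      using lin[of v] v(1) J' g0 unfolding pw.subspace_def Vector_Spaces.linear_iff by (auto simp: pscale_def)
    moreover have "?e ` J' - {?e v} \<subseteq> {x. g v (x v) = 0}" using ge[OF v(1)] by auto
    ultimately have "pw.span (?e ` J' - {?e v}) \<subseteq> {x. g v (x v) = 0}" by (rule pw.span_minimal[rotated])
    then show False using v ge[OF v(1) v(1)] by auto
  qed
  moreover have "pw.span (?e ` J') \<inter> direct_sum J N = {0}"
  proof
    show "pw.span (?e ` J') \<inter> direct_sum J N \<subseteq> {0}"
    proof
      fix x assume x: "x \<in> pw.span (?e ` J') \<inter> direct_sum J N"
      then have "g v (x v) = 0" if "v \<in> J'" for v using gN that J' by (auto simp: direct_sum_def)
      then have "s x = 0" unfolding s_def by (intro sum.neutral) simp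
      then show "x \<in> {0}" using span_E[of x] x by simp
    qed
    show "{0} \<subseteq> pw.span (?e ` J') \<inter> direct_sum J N"
      using N subspace_0 by (auto simp: direct_sum_def pw.span_zero)
  qed
  moreover have "pw.span (?e ` J' \<union> direct_sum J N) = direct_sum J U"
  proof
    show "pw.span (?e ` J' \<union> direct_sum J N) \<subseteq> direct_sum J U"
    proof (intro pw.span_minimal subspace_direct_sum U)
      show "?e ` J' \<union> direct_sum J N \<subseteq> direct_sum J U"
        using eU NU unfolding direct_sum_def by blast
    qed
    show "direct_sum J U \<subseteq> pw.span (?e ` J' \<union> direct_sum J N)"
    proof
      fix x assume x: "x \<in> direct_sum J U"
      have "x - s x \<in> direct_sum J N" 
        unfolding s_def by (rule direct_sum_reduce[OF J J' dec x])
      then have "x - s x \<in> pw.span (?e ` J' \<union> direct_sum J N)" by (simp add: pw.span_base)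
      moreover have "s x \<in> pw.span (?e ` J' \<union> direct_sum J N)"
        unfolding s_def by (intro pw.span_sum pw.span_scale pw.span_base) auto
      ultimately show "x \<in> pw.span (?e ` J' \<union> direct_sum J N)"
        using pw.span_add[of "x - s x" _ "s x"] by simp
    qed
  qed
  ultimately show ?thesis unfolding quotient_basis_def using finJ' eU by auto
qed

end

section \<open>A form that does not vanish on the subspace\<close>

context direct_sum_subspace
begin

text \<open>Some \<open>w \<in> W\<close> has a nonzero coordinate at a \<open>v \<in> J\<close>, so
  \<open>r {v} \<ge> 1\<close> and \<open>hyp\<close> applies to \<open>v\<close>. It lowers the
  value at \<open>V\<close> by at least 1, so \<open>a v\<close> cannot vanish on
  \<open>W\<close>.\<close>

lemma exists_functional_nonzero:
  assumes J: "J \<subseteq> V" and pos: "0 < r J"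
    and hyp: "\<And>v. v \<in> J \<Longrightarrow> (\<And>K. K \<subseteq> V \<Longrightarrow> 0 \<le> r K + xi {v} K) \<Longrightarrow>
      has_submod_fun scale V {w \<in> W. a v w = 0} (UpMin V (\<lambda>K. r K + xi {v} K))"
  obtains v w where "v \<in> J" "w \<in> W" "a v w \<noteq> 0"
proof -
  have "ker_proj J \<noteq> W" using r_plus_dim_ker[of J] pos by auto
  then obtain v w where v: "v \<in> J" "w \<in> W" "w v \<noteq> 0" by (auto simp: ker_proj_def)
  then have "ker_proj {v} \<subset> W" by (auto simp: ker_proj_def)
  then have "pw.dim (ker_proj {v}) < pw.dim W"
    using pw.dim_psubset_finite_dim finite_dim_W subspace_ker_proj by blast
  then have rv: "1 \<le> r {v}" using r_plus_dim_ker[of "{v}"] by linarith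
  let ?\<psi> = "\<lambda>K. r K + xi {v} K"
  have "has_submod_fun scale V {w \<in> W. a v w = 0} (UpMin V ?\<psi>)"
  proof (rule hyp[OF v(1)])
    fix K
    show "0 \<le> r K + xi {v} K"
    proof (cases "v \<in> K")
      case True
      then have "r {v} \<le> r K" by (intro r_mono) simp
      then show ?thesis using rv by (simp add: xi_def)
    next
      case False
      then show ?thesis using r_nonneg[of K] by (simp add: xi_def)
    qed
  qed
  then have "submod_fun scale {w \<in> W. a v w = 0} V = UpMin V ?\<psi> V" by (simp add: has_submod_fun_def)
  also have "\<dots> \<le> ?\<psi> V" by (intro UpMin_le finV order_refl)
  also have "\<dots> = r V - 1" using v J by (auto simp: xi_def)
  finally have "{w \<in> W. a v w = 0} \<noteq> W" by auto
  then show thesis using that v(1) by blast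
qed

end

section \<open>Translation of subspaces and hyperplanes into forms and coordinates\<close>

theorem theorem6p6:
  fixes scale :: "'k::field \<Rightarrow> 'u \<Rightarrow> 'u::ab_group_add"
    and V :: "'v set"
    and U :: "'v \<Rightarrow> 'u set"
    and W :: "('v \<Rightarrow> 'u) set"
    and \<phi> :: "'v set \<Rightarrow> int"
    and d :: nat
    and J :: "nat \<Rightarrow> 'v set"
    and N :: "nat \<Rightarrow> 'v \<Rightarrow> 'u set"
  assumes "vector_space scale"
    and "finite V"
    and "\<And>v. v \<in> V \<Longrightarrow> module.subspace scale (U v) \<and> finite_dim scale (U v)"
    and "module.subspace (pscale scale) W" and "W \<subseteq> direct_sum V U"
    and "\<phi> = submod_fun scale W"
    and "\<And>i. i \<in> {1..d} \<Longrightarrow> J i \<subseteq> V"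
    and "nonneg_on V (\<phi> + (\<Sum>i\<in>{1..d}. xi (J i)))"
    and "\<And>i v. i \<in> {1..d} \<Longrightarrow> v \<in> J i \<Longrightarrow> module.subspace scale (N i v) \<and> N i v \<subseteq> U v \<and>
           vector_space.dim scale (U v) \<le> vector_space.dim scale (N i v) + 1"
    and "\<And>S :: nat \<Rightarrow> 'v set. (\<And>i. i \<in> {1..d} \<Longrightarrow> S i \<subseteq> J i) \<Longrightarrow>
           nonneg_on V (\<phi> + (\<Sum>i\<in>{1..d}. \<Sum>v\<in>S i. xi {v})) \<Longrightarrow>
           has_submod_fun scale V
             (W \<inter> (\<Inter>i\<in>{1..d}. \<Inter>v\<in>S i. {x \<in> direct_sum V U. proj {v} x \<in> direct_sum {v} (N i)}))
             (UpMin V (\<phi> + (\<Sum>i\<in>{1..d}. \<Sum>v\<in>S i. xi {v})))"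
  shows "(\<forall>i\<in>{1..d}. direct_sum (J i) (N i) \<subset> direct_sum (J i) U) \<and>
    for_general_hyperplanes (pscale scale) {1..d}
      (\<lambda>i. direct_sum (J i) U) (\<lambda>i. direct_sum (J i) (N i))
      (\<lambda>H. has_submod_fun scale V
             (W \<inter> (\<Inter>i\<in>{1..d}. {x \<in> direct_sum V U. proj (J i) x \<in> H i}))
             (UpMin V (\<phi> + (\<Sum>i\<in>{1..d}. xi (J i)))))"
proof -
  define A where "A = {1..d}"
  have finA: "finite A" by (simp add: A_def)
  interpret vs: vector_space scale by fact
  interpret direct_sum_subspace scale V W
  proof
    show "finite_dim (pscale scale) W"
      using vs.finite_dim_direct_sum[of V U] assms(2,3,5) unfolding finite_dim_def by (meson subset_trans)
    show "w v = 0" if "w \<in> W" "v \<notin> V" for w v using that assms(5) by (auto simp: direct_sum_def)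
  qed (use assms in auto)
  have JV: "J i \<subseteq> V" if "i \<in> A" for i using assms(7) that by (simp add: A_def)
  have finJ: "finite (J i)" if "i \<in> A" for i using JV[OF that] assms(2) by (rule finite_subset)
  have WU: "w v \<in> U v" if "w \<in> W" "v \<in> V" for w v using that assms(5) by (auto simp: direct_sum_def)
  have U: "vs.subspace (U v)" "finite_dim scale (U v)" if "v \<in> V" for v using assms(3) that by auto
  have N: "vs.subspace (N i v)" "N i v \<subseteq> U v" "vs.dim (U v) \<le> vs.dim (N i v) + 1" if "i \<in> A" "v \<in> J i" for i v
    using assms(9) that by (auto simp: A_def)
  \<comment> \<open>The predicate ties each form to its complementary vector, so that both are
    chosen together.\<close>
  define Q where "Q i v g u \<longleftrightarrow> Vector_Spaces.linear scale (*) g \<and> u \<in> U v \<and> (\<forall>x\<in>N i v. g x = 0) \<and>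
    (N i v \<noteq> U v \<longrightarrow> g u = 1) \<and> (N i v = U v \<longrightarrow> g = (\<lambda>_. 0)) \<and> (\<forall>x\<in>U v. x - scale (g x) u \<in> N i v)"
    for i v and g :: "'u \<Rightarrow> 'k" and u
  have "\<exists>g u. i \<in> A \<longrightarrow> v \<in> J i \<longrightarrow> Q i v g u" for i v
  proof (cases "i \<in> A \<and> v \<in> J i")
    case True
    then have "v \<in> V" using JV by auto
    obtain g u where "Vector_Spaces.linear scale (*) g" "u \<in> U v" "\<And>x. x \<in> N i v \<Longrightarrow> g x = 0"
      "N i v \<noteq> U v \<Longrightarrow> g u = 1" "N i v = U v \<Longrightarrow> g = (\<lambda>_. 0)" "\<And>x. x \<in> U v \<Longrightarrow> x - scale (g x) u \<in> N i v"
      using vs.functional_with_kernel[of "N i v" "U v"] N[of i v] U[OF \<open>v \<in> V\<close>] True by metis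
    then show ?thesis unfolding Q_def by blast
  qed auto
  then obtain g u where gu: "\<And>i v. i \<in> A \<Longrightarrow> v \<in> J i \<Longrightarrow> Q i v (g i v) (u i v)" by metis
  have lin: "Vector_Spaces.linear scale (*) (g i v)" and uU: "u i v \<in> U v"
    and gN: "x \<in> N i v \<Longrightarrow> g i v x = 0" and gu1: "N i v \<noteq> U v \<Longrightarrow> g i v (u i v) = 1"
    and g0: "N i v = U v \<Longrightarrow> g i v = (\<lambda>_. 0)" and dec: "x \<in> U v \<Longrightarrow> x - scale (g i v x) (u i v) \<in> N i v"
    if "i \<in> A" "v \<in> J i" for i v x
    using gu[OF that] by (auto simp: Q_def)
  \<comment> \<open>\<open>J' i\<close> indexes the homogeneous coordinates of the
    \<open>i\<close>-th factor: a \<open>v\<close> with \<open>N i v = U v\<close> gives none.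
    \<open>a i v\<close> is the form pulled back to the direct sum, \<open>e i v\<close> the
    quotient basis vector.\<close>
  define J' where "J' i = {v \<in> J i. N i v \<noteq> U v}" for i
  define a where "a i v w = g i v (w v)" for i v and w :: "'v \<Rightarrow> 'u"
  define e where "e i v = coord v (u i v)" for i v
  have lin_a: "Vector_Spaces.linear (pscale scale) (*) (a i v)" if "i \<in> A" "v \<in> J i" for i v
    using lin[OF that] pw.vector_space_axioms
    unfolding Vector_Spaces.linear_iff a_def by (auto simp: pscale_def)
  have a_zero: "a i v w = 0 \<longleftrightarrow> w v \<in> N i v" if "i \<in> A" "v \<in> J i" "w \<in> W" for i v w
  proof
    have wv: "w v \<in> U v" using WU that JV by auto
    assume "a i v w = 0"
    then show "w v \<in> N i v" using dec[OF that(1,2) wv] by (simp add: a_def)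
  qed (use gN that in \<open>auto simp: a_def\<close>)
  have hyp: "has_submod_fun scale V {w \<in> W. \<forall>i\<in>T. a i (v i) w = 0} (UpMin V (\<lambda>K. r K + (\<Sum>i\<in>T. xi {v i} K)))"
    if T: "T \<subseteq> A" and v: "\<And>i. i \<in> T \<Longrightarrow> v i \<in> J i"
      and pos: "\<And>K. K \<subseteq> V \<Longrightarrow> 0 \<le> r K + (\<Sum>i\<in>T. xi {v i} K)" for T v
  proof -
    \<comment> \<open>Rado's theorem picks at most one element per index, so the hypothesis is used
      only for singletons and empty sets.\<close>
    define S where "S i = (if i \<in> T then {v i} else {})" for i
    have eq: "\<phi> + (\<Sum>i\<in>{1..d}. \<Sum>v\<in>S i. xi {v}) = (\<lambda>K. r K + (\<Sum>i\<in>T. xi {v i} K))"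
    proof
      fix K
      have "(\<Sum>i\<in>A. \<Sum>v\<in>S i. xi {v} K) = (\<Sum>i\<in>A. if i \<in> T then xi {v i} K else 0)"
        by (intro sum.cong) (auto simp: S_def)
      also have "\<dots> = (\<Sum>i\<in>T. xi {v i} K)"
        using finA T by (simp add: sum.inter_restrict[symmetric] Int_absorb1)
      finally show "(\<phi> + (\<Sum>i\<in>{1..d}. \<Sum>v\<in>S i. xi {v})) K = r K + (\<Sum>i\<in>T. xi {v i} K)"
        by (simp add: sum_fun_apply assms(6) A_def)
    qed
    have set: "W \<inter> (\<Inter>i\<in>{1..d}. \<Inter>v\<in>S i. {x \<in> direct_sum V U. proj {v} x \<in> direct_sum {v} (N i)})
        = {w \<in> W. \<forall>i\<in>T. a i (v i) w = 0}"
    proof -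
      have "proj {x} w \<in> direct_sum {x} (N i) \<longleftrightarrow> w x \<in> N i x" for x w i
        by (auto simp: proj_def direct_sum_def)
      moreover have "a i (v i) w = 0 \<longleftrightarrow> w (v i) \<in> N i (v i)" if "i \<in> T" "w \<in> W" for i w
        using a_zero[OF _ v] T that by blast
      ultimately show ?thesis using T assms(5) by (auto simp: S_def A_def split: if_splits)
    qed
    have "nonneg_on V (\<phi> + (\<Sum>i\<in>{1..d}. \<Sum>v\<in>S i. xi {v}))"
      unfolding eq nonneg_on_def using pos by blast
    moreover have "S i \<subseteq> J i" for i using v by (auto simp: S_def)
    ultimately show ?thesis using assms(10)[of S] unfolding eq set by blast
  qed
  have nonneg: "nonneg_on V (r + (\<Sum>i\<in>A. xi (J i)))" using assms(6,8) by (simp add: A_def)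
  have proper: "direct_sum (J i) (N i) \<subset> direct_sum (J i) U" if i: "i \<in> A" for i
  proof -
    have "0 < r (J i)"
    proof -
      \<comment> \<open>Nonnegativity is evaluated at \<open>J i\<close> itself, where index
        \<open>i\<close> contributes -1 and no index contributes a positive amount.\<close>
      have "0 \<le> r (J i) + (\<Sum>j\<in>A. xi (J j) (J i))"
        using nonneg JV[OF i] by (simp add: nonneg_on_def sum_fun_apply)
      moreover have "(\<Sum>j\<in>A. xi (J j) (J i)) \<le> (\<Sum>j\<in>{i}. xi (J j) (J i))"
        using finA i by (intro sum_mono2[where f = "\<lambda>j. - xi (J j) (J i)", simplified sum_negf neg_le_iff_le])
          (auto simp: xi_def)
      ultimately show ?thesis by (simp add: xi_def)
    qed
    then obtain v w where v: "v \<in> J i" "w \<in> W" "a i v w \<noteq> 0"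
    proof (rule exists_functional_nonzero[OF JV[OF i], where a = "a i"])
      fix v assume "v \<in> J i" "\<And>K. K \<subseteq> V \<Longrightarrow> 0 \<le> r K + xi {v} K"
      then show "has_submod_fun scale V {w \<in> W. a i v w = 0} (UpMin V (\<lambda>K. r K + xi {v} K))"
        using hyp[of "{i}" "\<lambda>_. v"] i by simp
    qed
    then have "N i v \<noteq> U v" using g0[OF i v(1)] by (auto simp: a_def)
    then have "u i v \<notin> N i v" using gu1[OF i v(1)] gN[OF i v(1)] by auto
    then have "coord v (u i v) \<notin> direct_sum (J i) (N i)" using v(1) by (auto simp: direct_sum_def coord_def)
    moreover have "coord v (u i v) \<in> direct_sum (J i) U"
      using v(1) uU[OF i v(1)] U vs.subspace_0 JV[OF i] by (auto simp: direct_sum_def coord_def)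
    moreover have "direct_sum (J i) (N i) \<subseteq> direct_sum (J i) U" using N(2)[OF i] unfolding direct_sum_def by blast
    ultimately show ?thesis by blast
  qed
  \<comment> \<open>Since \<open>g i v\<close> is 1 at \<open>u i v\<close>, this vector is nonzero,
    and the support of \<open>e i v\<close> determines \<open>v\<close>.\<close>
  have inj_e: "inj_on (e i) (J' i)" if "i \<in> A" for i
  proof (rule inj_onI)
    fix v v' assume v: "v \<in> J' i" "v' \<in> J' i" "e i v = e i v'"
    have "v \<in> J i" "N i v \<noteq> U v" using v(1) by (auto simp: J'_def)
    then have "g i v (u i v) = 1" "g i v 0 = 0"
      using gu1[OF that] gN[OF that _ vs.subspace_0[OF N(1)[OF that]]] by auto
    then have "u i v \<noteq> 0" by auto
    then show "v = v'" using fun_cong[OF v(3), of v] by (auto simp: e_def coord_def split: if_splits)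
  qed
  have a0: "a i v w = 0" if "i \<in> A" "v \<in> J i - J' i" for i v w
    using g0[OF that(1), of v] that by (auto simp: J'_def a_def)
  \<comment> \<open>The condition at \<open>I\<close> is phrased for a coefficient vector
    \<open>c\<close> and any forms with these coefficients on \<open>W\<close>, so that
    \<open>f\<close> can be chosen before the hyperplanes.\<close>
  define Q where "Q I c \<longleftrightarrow>
      (\<forall>L. (\<forall>i\<in>A. Vector_Spaces.linear (pscale scale) (*) (L i) \<and>
                   (\<forall>w\<in>W. L i w = (\<Sum>v\<in>J' i. c (i, e i v) * a i v w))) \<longrightarrow>
        int (pw.dim {x \<in> ker_proj I. \<forall>i\<in>A. L i x = 0})
          + UpMin V (r + (\<Sum>i\<in>A. xi (J i))) I + int (card A) \<le> int (pw.dim W))" for I c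
  have "\<exists>f. multihomogeneous A (\<lambda>i. e i ` J' i) f \<and> f \<noteq> 0 \<and>
    (\<forall>c. poly_eval f c \<noteq> 0 \<longrightarrow> (\<forall>I\<in>Pow V. Q I c))"
  proof (rule multihomogeneous_product)
    show "finite (Pow V)" using finV by simp
    fix I assume "I \<in> Pow V"
    then have "I \<subseteq> V" by simp
    show "\<exists>f. multihomogeneous A (\<lambda>i. e i ` J' i) f \<and> f \<noteq> 0 \<and> (\<forall>c. poly_eval f c \<noteq> 0 \<longrightarrow> Q I c)"
      unfolding Q_def
    proof (rule multihomogeneous_condition[OF finA JV _ lin_a _ inj_e hyp \<open>I \<subseteq> V\<close>])
      show "J' i \<subseteq> J i" for i by (auto simp: J'_def)
    qed (use a0 in auto)
  qed
  then obtain f where f: "multihomogeneous A (\<lambda>i. e i ` J' i) f" "f \<noteq> 0"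
    and cond: "\<And>c. poly_eval f c \<noteq> 0 \<Longrightarrow> \<forall>I\<in>Pow V. Q I c" by blast
  have "for_general_hyperplanes (pscale scale) A
      (\<lambda>i. direct_sum (J i) U) (\<lambda>i. direct_sum (J i) (N i))
      (\<lambda>H. has_submod_fun scale V
             (W \<inter> (\<Inter>i\<in>A. {x \<in> direct_sum V U. proj (J i) x \<in> H i}))
             (UpMin V (r + (\<Sum>i\<in>A. xi (J i)))))"
    unfolding for_general_hyperplanes_def
  \<comment> \<open>One polynomial suffices: \<open>f\<close> is the product of the minors over all
    \<open>I \<subseteq> V\<close>.\<close>
  proof (intro exI[of _ "\<lambda>i. e i ` J' i"] exI[of _ "{f}"] conjI ballI)
    fix i assume i: "i \<in> A"
    show "quotient_basis (pscale scale) (direct_sum (J i) U) (direct_sum (J i) (N i)) (e i ` J' i)"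
      unfolding e_def
    proof (rule vs.quotient_basis_direct_sum[OF finJ[OF i] J'_def U(1) N(1)[OF i] N(2)[OF i] uU[OF i]
          lin[OF i] gN[OF i] _ dec[OF i]])
      show "v \<in> V" if "v \<in> J i" for v using JV[OF i] that by auto
      show "g i v (u i v) = 1" if "v \<in> J' i" for v using gu1[OF i] that by (simp add: J'_def)
    qed
  next
    fix H
    assume "H \<in> zariski_open_points (pscale scale) A (\<lambda>i. direct_sum (J i) U)
        (\<lambda>i. direct_sum (J i) (N i)) (\<lambda>i. e i ` J' i) {f}"
    then obtain l where hyper: "\<forall>i\<in>A. hyperplane (pscale scale) (direct_sum (J i) U) (H i) \<and>
          direct_sum (J i) (N i) \<subseteq> H i"
      and lH: "\<forall>i\<in>A. Vector_Spaces.linear (pscale scale) (*) (l i) \<and>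
          H i = {x \<in> direct_sum (J i) U. l i x = 0}"
      and "\<exists>f'\<in>{f}. poly_eval f' (\<lambda>(i, e). l i e) \<noteq> 0"
      unfolding zariski_open_points_def by (elim CollectE conjE exE) (rule that)
    then have nz: "poly_eval f (\<lambda>(i, e). l i e) \<noteq> 0" by simp
    have NH: "direct_sum (J i) (N i) \<subseteq> H i" if "i \<in> A" for i using hyper that by simp
    have l: "Vector_Spaces.linear (pscale scale) (*) (l i)" if "i \<in> A" for i using lH that by simp
    have H: "H i = {x \<in> direct_sum (J i) U. l i x = 0}" if "i \<in> A" for i using lH that by simp
    define L where "L i w = l i (proj (J i) w)" for i w
    have projU: "proj (J i) w \<in> direct_sum (J i) U" if "i \<in> A" "w \<in> W" for i w
      using WU[OF that(2)] JV[OF that(1)] by (auto simp: proj_def direct_sum_def)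
    have linL: "Vector_Spaces.linear (pscale scale) (*) (L i)" if "i \<in> A" for i
      using l[OF that] linear_proj[of "J i"] unfolding L_def Vector_Spaces.linear_iff by auto
    \<comment> \<open>As \<open>l i\<close> vanishes on \<open>direct_sum (J i) (N i)\<close>, the
      coefficients of \<open>L i\<close> are its values on the quotient basis, that is, the
      homogeneous coordinates of \<open>H i\<close>.\<close>
    have L: "L i w = (\<Sum>v\<in>J' i. l i (e i v) * a i v w)" if i: "i \<in> A" and w: "w \<in> W" for i w
    proof -
      interpret l: Vector_Spaces.linear "pscale scale" "(*)" "l i" by (rule l[OF i])
      let ?p = "proj (J i) w"
      have "?p - (\<Sum>v\<in>J' i. pscale scale (g i v (?p v)) (coord v (u i v))) \<in> direct_sum (J i) (N i)"
        by (rule vs.direct_sum_reduce[OF finJ[OF i] J'_def dec[OF i] projU[OF i w]])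
      then have "l i (?p - (\<Sum>v\<in>J' i. pscale scale (g i v (?p v)) (coord v (u i v)))) = 0"
        using NH[OF i] H[OF i] by blast
      then have "l i ?p = (\<Sum>v\<in>J' i. g i v (?p v) * l i (e i v))"
        by (simp add: l.diff l.sum l.scale e_def)
      also have "\<dots> = (\<Sum>v\<in>J' i. l i (e i v) * a i v w)"
        by (intro sum.cong) (auto simp: a_def J'_def proj_def)
      finally show ?thesis by (simp add: L_def)
    qed
    have "has_submod_fun scale V {w \<in> W. \<forall>i\<in>A. L i w = 0} (UpMin V (r + (\<Sum>i\<in>A. xi (J i))))"
    proof (rule has_submod_fun_common_kernel[OF finA linL _ nonneg])
      fix i w assume i: "i \<in> A" and w: "w \<in> ker_proj (J i)"
      interpret l: Vector_Spaces.linear "pscale scale" "(*)" "l i" by (rule l[OF i])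
      have "proj (J i) w = 0" using w by (auto simp: ker_proj_def proj_def fun_eq_iff)
      then show "L i w = 0" by (simp add: L_def l.zero)
    next
      fix I assume "I \<subseteq> V"
      then have "Q I (\<lambda>(i, e). l i e)" using cond[OF nz] by blast
      moreover have "\<forall>i\<in>A. Vector_Spaces.linear (pscale scale) (*) (L i) \<and>
          (\<forall>w\<in>W. L i w = (\<Sum>v\<in>J' i. (\<lambda>(i, e). l i e) (i, e i v) * a i v w))"
        using linL L by simp
      ultimately show "int (pw.dim {x \<in> ker_proj I. \<forall>i\<in>A. L i x = 0})
          + UpMin V (r + (\<Sum>i\<in>A. xi (J i))) I + int (card A) \<le> int (pw.dim W)"
        unfolding Q_def by blast
    qed
    moreover have "W \<inter> (\<Inter>i\<in>A. {x \<in> direct_sum V U. proj (J i) x \<in> H i}) = {w \<in> W. \<forall>i\<in>A. L i w = 0}"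
      using assms(5) projU H by (auto simp: L_def)
    ultimately show "has_submod_fun scale V
             (W \<inter> (\<Inter>i\<in>A. {x \<in> direct_sum V U. proj (J i) x \<in> H i}))
             (UpMin V (r + (\<Sum>i\<in>A. xi (J i))))" by simp
  qed (use f in auto)
  then show ?thesis using proper assms(6) unfolding A_def by blast
qed

end
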